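(* Let $\rho\ge2$ be an integer, and consider the cross-neighborhood growth dynamics of range $\rho$ with the line growth zero-set with parameters $r=s=2$, that is, $\mathcal Z=\{0,1\}\times\{0,1\}$. Then, as $p\to0$, $$T\asymp p^{-1}\log p^{-1}\qquad\text{and}\qquad L_c\asymp p^{-1}.$$
   Context: Given an integer range $\rho$, for $x\in\mathbb Z^2$ let $\mathcal N^h_x=x+([-\rho,\rho]\cap\mathbb Z)\times\{0\}$ and $\mathcal N^v_x=x+\{0\}\times([-\rho,\rho]\cap\mathbb Z)$. Given $\xi_0\subseteq\mathbb Z^2$, define recursively, for $t\ge0$, $$\xi_{t+1}=\xi_t\cup\{x\in\mathbb Z^2:(|\mathcal N_x^h\cap\xi_t|,|\mathcal N_x^v\cap\xi_t|)\notin\mathcal Z\}.$$ Each $x\in\mathbb Z^2$ is included in $\xi_0$ independently with probability $p\in[0,1]$, and $T=\inf\{t\ge0:(0,0)\in\xi_t\}$. Let $B_n=[0,n-1]^2\cap\mathbb Z^2$. The dynamics on $B_n$ with $0$-boundary is defined by restricting the initial set to $B_n$ (each site of $B_n$ initially occupied independently with probability $p$) and by considering only $x\in B_n$ for occupation at all times. The box $B_n$ is spanned if this dynamics eventually occupies every point of $B_n$. The critical length is $L_c=\inf\{n\ge1:\mathbb P(B_n\text{ is spanned})\ge1/2\}$. For a deterministic $a=a(p)$ and nonnegative random variables $X=X(p)$ (possibly deterministic): $X\lesssim a$ means $\lim_{\lambda\to\infty}\limsup_{p\to0}\mathbb P(X\ge\lambda a)=0$; $X\gtrsim a$ means $\lim_{\lambda\to0}\limsup_{p\to0}\mathbb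 P(X\le\lambda a)=0$; $X\asymp a$ means both. For the deterministic quantity $L_c$, $L_c\asymp p^{-1}$ is the statement $L_c=\Theta(p^{-1})$ as $p\to0$. *)

theory Defs
  imports "HOL-Probability.Probability" "HOL-Library.Landau_Symbols"
begin

section \<open>Cross-neighborhood growth dynamics\<close>

definition nbhd_h :: "int \<Rightarrow> int \<times> int \<Rightarrow> (int \<times> int) set" where
  "nbhd_h \<rho> x = (\<lambda>i. x + (i, 0)) ` {-\<rho>..\<rho>}"

definition nbhd_v :: "int \<Rightarrow> int \<times> int \<Rightarrow> (int \<times> int) set" where
  "nbhd_v \<rho> x = (\<lambda>j. x + (0, j)) ` {-\<rho>..\<rho>}"

text \<open>
  One step of the dynamics in which only the points of \<open>\<Lambda>\<close> are considered for occupation: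
  \<open>\<Lambda> = UNIV\<close> is the dynamics on the whole lattice, and \<open>\<Lambda> = lattice_box n\<close>, started from a
  subset of \<open>lattice_box n\<close>, is the dynamics on the box with 0-boundary.
\<close>
definition growth_step ::
  "(int \<times> int) set \<Rightarrow> int \<Rightarrow> (nat \<times> nat) set \<Rightarrow> (int \<times> int) set \<Rightarrow> (int \<times> int) set" where
  "growth_step \<Lambda> \<rho> Z \<xi> =
     \<xi> \<union> {x \<in> \<Lambda>. (card (nbhd_h \<rho> x \<inter> \<xi>), card (nbhd_v \<rho> x \<inter> \<xi>)) \<notin> Z}"

definition growth ::
  "(int \<times> int) set \<Rightarrow> int \<Rightarrow> (nat \<times> nat) set \<Rightarrow> (int \<times> int) set \<Rightarrow> nat \<Rightarrow> (int \<times> int) set" where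
  "growth \<Lambda> \<rho> Z \<xi>\<^sub>0 t = (growth_step \<Lambda> \<rho> Z ^^ t) \<xi>\<^sub>0"

text \<open>The infimum is taken in \<^typ>\<open>enat\<close>, so it is \<open>\<infinity>\<close> if the origin is never occupied.\<close>
definition occupation_time :: "int \<Rightarrow> (nat \<times> nat) set \<Rightarrow> (int \<times> int) set \<Rightarrow> enat" where
  "occupation_time \<rho> Z \<xi>\<^sub>0 = (INF t \<in> {t. (0, 0) \<in> growth UNIV \<rho> Z \<xi>\<^sub>0 t}. enat t)"

definition lattice_box :: "nat \<Rightarrow> (int \<times> int) set" where
  "lattice_box n = {0..int n - 1} \<times> {0..int n - 1}"

definition spans_box :: "int \<Rightarrow> (nat \<times> nat) set \<Rightarrow> nat \<Rightarrow> (int \<times> int) set \<Rightarrow> bool" where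
  "spans_box \<rho> Z n \<xi>\<^sub>0 \<longleftrightarrow> lattice_box n \<subseteq> (\<Union>t. growth (lattice_box n) \<rho> Z (\<xi>\<^sub>0 \<inter> lattice_box n) t)"

section \<open>Random initial set\<close>

text \<open>
  The initial set of a sample point \<open>\<omega>\<close> is \<^term>\<open>Collect \<omega>\<close>.
\<close>
definition site_measure :: "real \<Rightarrow> (int \<times> int \<Rightarrow> bool) measure" where
  "site_measure p = (\<Pi>\<^sub>M x\<in>UNIV. measure_pmf (bernoulli_pmf p))"

text \<open>Again the infimum is \<open>\<infinity>\<close> if there is no such \<open>n\<close>.\<close>
definition critical_length :: "int \<Rightarrow> (nat \<times> nat) set \<Rightarrow> real \<Rightarrow> enat" where
  "critical_length \<rho> Z p =
     (INF n \<in> {n. 1 \<le> n \<and> \<P>(\<omega> in site_measure p. spans_box \<rho> Z n (Collect \<omega>)) \<ge> 1 / 2}. enat n)"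

section \<open>Asymptotics of random variables as \<open>p\<close> tends to 0\<close>

text \<open>
  \<open>X p\<close> is a nonnegative random variable on \<open>M p\<close>, possibly with the value \<open>\<infinity>\<close>.
\<close>
definition prob_lesssim ::
  "(real \<Rightarrow> 'a measure) \<Rightarrow> (real \<Rightarrow> 'a \<Rightarrow> ereal) \<Rightarrow> (real \<Rightarrow> real) \<Rightarrow> bool" where
  "prob_lesssim M X a \<longleftrightarrow>
     ((\<lambda>l. Limsup (at_right 0) (\<lambda>p. ereal \<P>(\<omega> in M p. X p \<omega> \<ge> ereal (l * a p)))) \<longlongrightarrow> 0) at_top"

definition prob_gtrsim ::
  "(real \<Rightarrow> 'a measure) \<Rightarrow> (real \<Rightarrow> 'a \<Rightarrow> ereal) \<Rightarrow> (real \<Rightarrow> real) \<Rightarrow> bool" where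
  "prob_gtrsim M X a \<longleftrightarrow>
     ((\<lambda>l. Limsup (at_right 0) (\<lambda>p. ereal \<P>(\<omega> in M p. X p \<omega> \<le> ereal (l * a p)))) \<longlongrightarrow> 0) (at_right 0)"

definition prob_asymp ::
  "(real \<Rightarrow> 'a measure) \<Rightarrow> (real \<Rightarrow> 'a \<Rightarrow> ereal) \<Rightarrow> (real \<Rightarrow> real) \<Rightarrow> bool" where
  "prob_asymp M X a \<longleftrightarrow> prob_lesssim M X a \<and> prob_gtrsim M X a"

end

(*
  A full line is created by two close initial sites on a line, or by a full perpendicular line and an
  initial site close to it. Hence full lines branch: a full line segment of length A/p passes
  about A initial sites, each of which creates a perpendicular line.

  Upper bounds: restricted to the even rows and columns of a box of side C/p, the creation of
  lines contains a random directed bipartite graph with independent edges and average degree of order C.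
  A union bound over the possible first steps at which the set reached from a row fails to double shows
  that, for large C, more than half of the rows or columns are reached after O(log (1/p)) steps, each
  of which takes time O(1/p). Then two consecutive even lines are full and the box fills. A row from
  which to start exists because the box contains about C^2 close pairs of sites.

  Lower bounds: a box of side c/p contains no close pair with high probability. For the occupation time,
  follow the line through the origin back in time through the lines that created it. The expected
  number of such histories of duration l/p log (1/p) grows like p powr (- O(l)), while the pair in which
  a history ends costs p^2. This argument only breaks down if two close parallel lines become full, and
  this forces an initial site close to both a full row and a full column that do not depend on it (or a
  close pair near a full line). As there are at most p powr (- O(l)) full lines within reach, such sites
  are unlikely to exist.
*)

theory Submission
  imports Defs "HOL-Real_Asymp.Real_Asymp"
begin

text \<open>Concentration cannot control the exploration in its first steps, where only few lines
  are reached; a failed step therefore pays for the whole history that led to it. Each edge that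
  created a reached line costs a factor p, the edges missing at the failed step cost exp(-pN/4) per
  reached line, and the number of choices is compensated by factorials. The union bound becomes a
  geometric series of ratio of order C exp(-C/4), and the factor p^2 of the initial pair cancels the
  number of possible pairs.

  For the lower bounds on the time, the obstacle is dependence: a history that uses an initial site
  twice pays for it only once. Histories are therefore required to use each site once, which gives a
  recursion in the remaining distance with growth factor 1 + O(p) per unit. A reused site either
  lets the history be restarted there with fewer sites or produces two close parallel lines; these
  would start a perpendicular line at every position, and ruling them out is the purpose of the
  danger events.\<close>

section \<open>Random subsets of a finite set\<close>

text \<open>The finite counterpart of \<open>site_measure\<close>: on a finite box all events are
  measurable and expectations are finite sums, so the estimates are made here and transferred to the
  infinite product afterwards.\<close>

definition random_subset :: "'a set \<Rightarrow> real \<Rightarrow> 'a set pmf" where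
  "random_subset F p = map_pmf Collect (Pi_pmf F False (\<lambda>_. bernoulli_pmf p))"

abbreviation rprob :: "'a set \<Rightarrow> real \<Rightarrow> ('a set \<Rightarrow> bool) \<Rightarrow> real" where
  "rprob F p E \<equiv> measure_pmf.prob (random_subset F p) {X. E X}"

lemma set_random_subset:
  assumes "finite F"
  shows "set_pmf (random_subset F p) \<subseteq> Pow F"
  using set_Pi_pmf_subset[OF assms, of False "\<lambda>_. bernoulli_pmf p"]
  by (auto simp: random_subset_def)

lemma finite_set_random_subset: "finite F \<Longrightarrow> finite (set_pmf (random_subset F p))"
  using finite_subset[OF set_random_subset] by auto

lemma prob_pmf_mono:
  assumes "\<And>X. X \<in> set_pmf M \<Longrightarrow> P X \<Longrightarrow> Q X"
  shows "measure_pmf.prob M {X. P X} \<le> measure_pmf.prob M {X. Q X}"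
proof -
  have "measure_pmf.prob M {X. P X} = measure_pmf.prob M ({X. P X} \<inter> set_pmf M)"
    by (simp add: measure_Int_set_pmf)
  also have "\<dots> \<le> measure_pmf.prob M {X. Q X}"
    by (rule measure_pmf.finite_measure_mono) (use assms in auto)
  finally show ?thesis .
qed

lemma rprob_mono:
  assumes "finite F" "\<And>X. X \<subseteq> F \<Longrightarrow> P X \<Longrightarrow> Q X"
  shows "rprob F p P \<le> rprob F p Q"
  by (rule prob_pmf_mono) (use assms set_random_subset[OF assms(1), of p] in auto)

lemma rprob_cong:
  assumes "finite F" "\<And>X. X \<subseteq> F \<Longrightarrow> P X \<longleftrightarrow> Q X"
  shows "rprob F p P = rprob F p Q"
  by (rule antisym; rule rprob_mono) (use assms in auto)

lemma rprob_disj: "rprob F p (\<lambda>X. P X \<or> Q X) \<le> rprob F p P + rprob F p Q"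
proof -
  have "rprob F p (\<lambda>X. P X \<or> Q X) = measure_pmf.prob (random_subset F p) ({X. P X} \<union> {X. Q X})"
    by (rule arg_cong[of _ _ "measure_pmf.prob _"]) auto
  also have "\<dots> \<le> rprob F p P + rprob F p Q"
    by (rule measure_Un_le) auto
  finally show ?thesis .
qed

lemma rprob_Bex:
  assumes "finite I"
  shows "rprob F p (\<lambda>X. \<exists>i\<in>I. P i X) \<le> (\<Sum>i\<in>I. rprob F p (P i))"
proof -
  have "rprob F p (\<lambda>X. \<exists>i\<in>I. P i X) = measure_pmf.prob (random_subset F p) (\<Union>i\<in>I. {X. P i X})"
    by (rule arg_cong[of _ _ "measure_pmf.prob _"]) auto
  also have "\<dots> \<le> (\<Sum>i\<in>I. rprob F p (P i))"
    by (rule measure_pmf.finite_measure_subadditive_finite) (use assms in auto)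
  finally show ?thesis .
qed

lemma rprob_Bex_le:
  assumes "finite I" "\<And>i. i \<in> I \<Longrightarrow> rprob F p (P i) \<le> c"
  shows "rprob F p (\<lambda>X. \<exists>i\<in>I. P i X) \<le> real (card I) * c"
  using order_trans[OF rprob_Bex[OF assms(1)] sum_bounded_above[of I _ c, OF assms(2)]] by simp

lemma random_subset_insert:
  assumes "finite F" "x \<notin> F"
  shows "random_subset (insert x F) p =
    bind_pmf (bernoulli_pmf p) (\<lambda>b. map_pmf (\<lambda>A. if b then insert x A else A) (random_subset F p))"
proof -
  have *: "Collect (f(x := y)) = (if y then insert x (Collect f) else Collect f)"
    if "f \<in> set_pmf (Pi_pmf F False (\<lambda>_. bernoulli_pmf p))" for f y
    using that set_Pi_pmf_subset[OF assms(1), of False "\<lambda>_. bernoulli_pmf p"] assms(2)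
    by (fastforce split: if_splits)
  show ?thesis
    unfolding random_subset_def Pi_pmf_insert'[OF assms] map_bind_pmf
    by (auto simp: map_pmf_def bind_assoc_pmf bind_return_pmf * intro!: bind_pmf_cong)
qed

lemma rprob_insert:
  assumes "finite F" "x \<notin> F" "0 \<le> p" "p \<le> 1"
  shows "rprob (insert x F) p E = p * rprob F p (\<lambda>X. E (insert x X)) + (1 - p) * rprob F p E"
proof -
  have "ennreal (rprob (insert x F) p E)
      = ennreal (p * rprob F p (\<lambda>X. E (insert x X)) + (1 - p) * rprob F p E)"
    unfolding random_subset_insert[OF assms(1,2)] measure_pmf.emeasure_eq_measure[symmetric]
      emeasure_bind_pmf
    using assms(3,4)
    by (simp add: vimage_def measure_pmf.emeasure_eq_measure ennreal_mult' ennreal_plus mult.commute)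
  thus ?thesis using assms(3,4) by (subst (asm) ennreal_inj) auto
qed

section \<open>Independence of one site from the others\<close>

lemma rprob_present:
  assumes "finite F" "u \<in> F" "0 \<le> p" "p \<le> 1"
  shows "rprob F p (\<lambda>X. u \<in> X \<and> E (X - {u})) = p * rprob (F - {u}) p E"
proof -
  have F: "F = insert u (F - {u})" using assms by auto
  have fin: "finite (F - {u})" using assms by simp
  have 1: "rprob (F - {u}) p (\<lambda>X. u \<in> insert u X \<and> E (insert u X - {u})) = rprob (F - {u}) p E"
    by (rule rprob_cong[OF fin]) (metis Diff_iff Diff_insert_absorb insertI1 subset_iff)
  have 2: "rprob (F - {u}) p (\<lambda>X. u \<in> X \<and> E (X - {u})) = rprob (F - {u}) p (\<lambda>X. False)"
    by (rule rprob_cong[OF fin]) auto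
  show ?thesis
    by (subst F, subst rprob_insert) (use assms 1 2 in auto)
qed

lemma rprob_absent:
  assumes "finite F" "u \<in> F" "0 \<le> p" "p \<le> 1"
  shows "rprob F p (\<lambda>X. u \<notin> X \<and> E X) = (1 - p) * rprob (F - {u}) p E"
proof -
  have F: "F = insert u (F - {u})" using assms by auto
  have fin: "finite (F - {u})" using assms by simp
  have 2: "rprob (F - {u}) p (\<lambda>X. u \<notin> X \<and> E X) = rprob (F - {u}) p E"
    by (rule rprob_cong[OF fin]) auto
  show ?thesis
    by (subst F, subst rprob_insert) (use assms 2 in auto)
qed

text \<open>\<open>E (X - {u})\<close> does not depend on the state of \<open>u\<close>, and for
  increasing \<open>E\<close> it implies \<open>E X\<close>. The bound thus stays on the same box
  \<open>F\<close>, which lets it be iterated.\<close>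

lemma rprob_present_mono:
  assumes "finite F" "0 \<le> p" "p \<le> 1" "\<And>X Y. X \<subseteq> Y \<Longrightarrow> E X \<Longrightarrow> E Y"
  shows "rprob F p (\<lambda>X. u \<in> X \<and> E (X - {u})) \<le> p * rprob F p E"
proof (cases "u \<in> F")
  case True
  have "rprob (F - {u}) p E = rprob F p (\<lambda>X. u \<in> X \<and> E (X - {u})) + rprob F p (\<lambda>X. u \<notin> X \<and> E X)"
    using rprob_present[OF assms(1) True assms(2,3), of E]
      rprob_absent[OF assms(1) True assms(2,3), of E] by (simp add: algebra_simps)
  also have "\<dots> = measure_pmf.prob (random_subset F p)
      ({X. u \<in> X \<and> E (X - {u})} \<union> {X. u \<notin> X \<and> E X})"
    by (rule measure_pmf.finite_measure_Union[symmetric]) auto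
  also have "\<dots> \<le> rprob F p E"
    by (rule measure_pmf.finite_measure_mono) (auto intro: assms(4)[OF Diff_subset])
  finally show ?thesis
    unfolding rprob_present[OF assms(1) True assms(2,3)] using assms(2) by (rule mult_left_mono)
next
  case False
  have "rprob F p (\<lambda>X. u \<in> X \<and> E (X - {u})) = rprob F p (\<lambda>X. False)"
    by (rule rprob_cong) (use assms False in auto)
  thus ?thesis using assms by simp
qed

text \<open>The substitute for events that are not monotone: going back from \<open>F - {u}\<close>
  to \<open>F\<close> means asking for the absence of \<open>u\<close>, which has probability at
  least 1/2.\<close>

lemma rprob_present_absent:
  assumes "finite F" "u \<in> F" "0 \<le> p" "p \<le> 1/2"
  shows "rprob F p (\<lambda>X. u \<in> X \<and> E (X - {u})) \<le> 2 * p * rprob F p E"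
proof -
  have "rprob F p (\<lambda>X. u \<notin> X \<and> E X) \<le> rprob F p E"
    by (rule rprob_mono) (use assms in auto)
  hence "(1 - p) * rprob (F - {u}) p E \<le> rprob F p E"
    using rprob_absent[of F u p E] assms by simp
  moreover have "1/2 * rprob (F - {u}) p E \<le> (1 - p) * rprob (F - {u}) p E"
    using assms by (intro mult_right_mono) auto
  ultimately have "rprob (F - {u}) p E \<le> 2 * rprob F p E" by simp
  hence "p * rprob (F - {u}) p E \<le> p * (2 * rprob F p E)"
    using assms by (intro mult_left_mono) auto
  thus ?thesis using rprob_present[of F u p E] assms by simp
qed

lemma rprob_cylinder:
  assumes "finite F" "A \<subseteq> F" "B \<subseteq> F" "A \<inter> B = {}" "0 \<le> p" "p \<le> 1"
  shows "rprob F p (\<lambda>X. A \<subseteq> X \<and> B \<inter> X = {}) = p ^ card A * (1 - p) ^ card B"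
proof -
  define C where "C x = (if x \<in> A then {True} else if x \<in> B then {False} else UNIV)" for x
  have eq: "{f. A \<subseteq> Collect f \<and> B \<inter> Collect f = {}} = Pi F C"
    using assms by (auto simp: C_def Pi_def split: if_splits)
  have "rprob F p (\<lambda>X. A \<subseteq> X \<and> B \<inter> X = {})
      = measure_pmf.prob (Pi_pmf F False (\<lambda>_. bernoulli_pmf p)) (Pi F C)"
    by (simp add: random_subset_def vimage_def eq)
  also have "\<dots> = (\<Prod>x\<in>F. measure_pmf.prob (bernoulli_pmf p) (C x))"
    using assms by (intro measure_Pi_pmf_Pi) auto
  also have "\<dots> = (\<Prod>x\<in>F. (if x \<in> A then p else 1) * (if x \<in> B then 1 - p else 1))"
    using assms by (intro prod.cong) (auto simp: C_def measure_pmf_single)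
  also have "\<dots> = (\<Prod>x\<in>F \<inter> A. p) * (\<Prod>x\<in>F \<inter> B. 1 - p)"
    unfolding prod.distrib prod.inter_restrict[OF assms(1)] ..
  also have "\<dots> = p ^ card A * (1 - p) ^ card B"
    using assms by (simp add: Int_absorb1)
  finally show ?thesis .
qed

lemma rprob_subset:
  assumes "finite F" "0 \<le> p" "p \<le> 1" "finite A"
  shows "rprob F p (\<lambda>X. A \<subseteq> X) \<le> p ^ card A"
proof (cases "A \<subseteq> F")
  case True
  thus ?thesis using rprob_cylinder[of F A "{}" p] assms by simp
next
  case False
  have "rprob F p (\<lambda>X. A \<subseteq> X) = rprob F p (\<lambda>X. False)"
    by (rule rprob_cong) (use assms False in auto)
  thus ?thesis using assms by simp
qed

text \<open>Disjoint pairs are independent. The box varies in the induction because revealing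
  \<open>a j\<close>, and then \<open>b j\<close>, removes these sites from it.\<close>

lemma rprob_no_pair:
  assumes "finite J" "finite F" "a ` J \<union> b ` J \<subseteq> F" "inj_on a J" "inj_on b J" "a ` J \<inter> b ` J = {}"
    "0 \<le> p" "p \<le> 1"
  shows "rprob F p (\<lambda>X. \<forall>j\<in>J. \<not> (a j \<in> X \<and> b j \<in> X)) = (1 - p\<^sup>2) ^ card J"
  using assms
proof (induction J arbitrary: F rule: finite_induct)
  case (insert j J)
  let ?np = "\<lambda>X. \<forall>j\<in>J. \<not> (a j \<in> X \<and> b j \<in> X)"
  have neq: "a i \<noteq> a j \<and> a i \<noteq> b j \<and> b i \<noteq> a j \<and> b i \<noteq> b j" if "i \<in> J" for i
    using that insert.prems insert.hyps by (auto simp: inj_on_insert image_iff)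
  have neq': "a j \<noteq> b j" using insert.prems(5) by auto
  have inj: "inj_on a J" "inj_on b J" "a ` J \<inter> b ` J = {}"
    using insert.prems(3-5) by (auto simp: inj_on_insert)
  have sub: "a ` J \<union> b ` J \<subseteq> F - {a j} - {b j}"
  proof
    fix x assume "x \<in> a ` J \<union> b ` J"
    then obtain i where i: "i \<in> J" "x = a i \<or> x = b i" by blast
    have "a i \<in> F" "b i \<in> F" using i(1) insert.prems(2) by auto
    thus "x \<in> F - {a j} - {b j}" using i(2) neq[OF i(1)] by (elim disjE) simp_all
  qed
  have sub1: "a ` J \<union> b ` J \<subseteq> F - {a j}" using sub by (rule subset_trans) (rule Diff_subset)
  have fin: "finite (F - {a j})" "finite (F - {a j} - {b j})" using insert.prems(1) by auto
  have inF: "a j \<in> F" "b j \<in> F" using insert.prems(2) by simp_all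
  have F1: "F = insert (a j) (F - {a j})" using inF(1) by blast
  have bF: "b j \<in> F - {a j}" using inF(2) neq' by simp
  have IH1: "rprob (F - {a j}) p ?np = (1 - p\<^sup>2) ^ card J"
    by (rule insert.IH) (use sub1 inj fin insert.prems(6,7) in simp_all)
  have IH2: "rprob (F - {a j} - {b j}) p ?np = (1 - p\<^sup>2) ^ card J"
    by (rule insert.IH) (use sub inj fin insert.prems(6,7) in simp_all)
  have 1: "rprob (F - {a j}) p (\<lambda>X. \<forall>i\<in>insert j J. \<not> (a i \<in> X \<and> b i \<in> X)) = rprob (F - {a j}) p ?np"
  proof (rule rprob_cong[OF fin(1)])
    fix X assume "X \<subseteq> F - {a j}"
    hence "a j \<notin> X" by blast
    thus "(\<forall>i\<in>insert j J. \<not> (a i \<in> X \<and> b i \<in> X)) \<longleftrightarrow> ?np X" by simp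
  qed
  have "rprob (F - {a j}) p (\<lambda>X. \<forall>i\<in>insert j J. \<not> (a i \<in> insert (a j) X \<and> b i \<in> insert (a j) X))
      = rprob (F - {a j}) p (\<lambda>X. b j \<notin> X \<and> ?np X)"
    using neq neq' by (intro rprob_cong[OF fin(1)]) simp
  also have "\<dots> = (1 - p) * (1 - p\<^sup>2) ^ card J"
    using rprob_absent[OF fin(1) bF insert.prems(6,7), of ?np] unfolding IH2 .
  finally have 2: "rprob (F - {a j}) p (\<lambda>X. \<forall>i\<in>insert j J. \<not> (a i \<in> insert (a j) X \<and> b i \<in> insert (a j) X))
      = (1 - p) * (1 - p\<^sup>2) ^ card J" .
  have "rprob F p (\<lambda>X. \<forall>i\<in>insert j J. \<not> (a i \<in> X \<and> b i \<in> X))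
      = p * ((1 - p) * (1 - p\<^sup>2) ^ card J) + (1 - p) * (1 - p\<^sup>2) ^ card J"
    using rprob_insert[OF fin(1) _ insert.prems(6,7), of "a j"
      "\<lambda>X. \<forall>i\<in>insert j J. \<not> (a i \<in> X \<and> b i \<in> X)"]
    unfolding 1 2 IH1 F1[symmetric] by blast
  also have "\<dots> = (1 - p\<^sup>2) ^ card (insert j J)"
    using insert.hyps by (simp add: algebra_simps power2_eq_square)
  finally show ?case .
qed simp

section \<open>First moments of counts\<close>

lemma expectation_card:
  assumes "finite (set_pmf M)" "finite I"
  shows "measure_pmf.expectation M (\<lambda>X. real (card {i\<in>I. E i X})) = (\<Sum>i\<in>I. measure_pmf.prob M {X. E i X})"
proof -
  have "real (card {i\<in>I. E i X}) = (\<Sum>i\<in>I. indicator {X. E i X} X)" for X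
    using assms(2) by (simp add: indicator_def sum.If_cases Int_def)
  hence "measure_pmf.expectation M (\<lambda>X. real (card {i\<in>I. E i X}))
      = (\<Sum>i\<in>I. measure_pmf.expectation M (indicator {X. E i X}))"
    by (simp add: Bochner_Integration.integral_sum integrable_measure_pmf_finite[OF assms(1)])
  thus ?thesis by simp
qed

text \<open>The sum is the expected number of events that occur.\<close>

lemma sum_prob_le_card:
  assumes "finite (set_pmf M)" "finite I" "\<And>X. X \<in> set_pmf M \<Longrightarrow> card {i\<in>I. E i X} \<le> c"
  shows "(\<Sum>i\<in>I. measure_pmf.prob M {X. E i X}) \<le> real c"
  unfolding expectation_card[OF assms(1,2), symmetric]
  by (rule measure_pmf.integral_le_const)
     (use assms in \<open>auto simp: integrable_measure_pmf_finite AE_measure_pmf_iff\<close>)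

lemma prob_card_ge:
  assumes "finite (set_pmf M)" "finite I" "m > 0"
  shows "measure_pmf.prob M {X. real (card {i\<in>I. E i X}) \<ge> m}
    \<le> (\<Sum>i\<in>I. measure_pmf.prob M {X. E i X}) / m"
  using integral_Markov_inequality_measure[of M "\<lambda>X. real (card {i\<in>I. E i X})" "{}" m]
    expectation_card[OF assms(1,2), of E] assms
  by (simp add: integrable_measure_pmf_finite)

section \<open>Events of the infinite product that depend on finitely many sites\<close>

lemma prob_space_site_measure: "prob_space (site_measure p)"
  unfolding site_measure_def by (intro prob_space_PiM prob_space_measure_pmf)

lemma space_site_measure [simp]: "space (site_measure p) = UNIV"
  by (simp add: site_measure_def space_PiM)

lemma site_measure_atom:
  assumes "finite F" "A \<subseteq> F" "0 \<le> p" "p \<le> 1"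
  shows "{\<omega>. Collect \<omega> \<inter> F = A} \<in> sets (site_measure p)"
    and "measure (site_measure p) {\<omega>. Collect \<omega> \<inter> F = A} = rprob F p (\<lambda>X. X = A)"
proof -
  interpret P: product_prob_space "\<lambda>_::int\<times>int. measure_pmf (bernoulli_pmf p)" UNIV
    by unfold_locales
  let ?emb = "prod_emb UNIV (\<lambda>_::int\<times>int. measure_pmf (bernoulli_pmf p)) F (Pi\<^sub>E F (\<lambda>x. {x \<in> A}))"
  have eq: "{\<omega>. Collect \<omega> \<inter> F = A} = ?emb"
    using assms(2) by (auto simp: prod_emb_def space_PiM PiE_iff)
  show "{\<omega>. Collect \<omega> \<inter> F = A} \<in> sets (site_measure p)"
    unfolding eq site_measure_def using assms(1) by (intro sets_PiM_I) auto
  have "measure (site_measure p) {\<omega>. Collect \<omega> \<inter> F = A}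
      = (\<Prod>x\<in>F. measure_pmf.prob (bernoulli_pmf p) {x \<in> A})"
    unfolding eq site_measure_def using assms(1) by (intro P.measure_PiM_emb) auto
  also have "\<dots> = measure_pmf.prob (Pi_pmf F False (\<lambda>_. bernoulli_pmf p)) (PiE_dflt F False (\<lambda>x. {x \<in> A}))"
    using assms(1) by (simp add: measure_Pi_pmf_PiE_dflt)
  also have "PiE_dflt F False (\<lambda>x. {x \<in> A}) = Collect -` {A}"
    using assms(2) unfolding PiE_dflt_def vimage_def by blast
  finally show "measure (site_measure p) {\<omega>. Collect \<omega> \<inter> F = A} = rprob F p (\<lambda>X. X = A)"
    by (simp add: random_subset_def)
qed

lemma site_measure_finite_event:
  assumes "finite F" "0 \<le> p" "p \<le> 1"
  shows "{\<omega>. E (Collect \<omega> \<inter> F)} \<in> sets (site_measure p)"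
    and "measure (site_measure p) {\<omega>. E (Collect \<omega> \<inter> F)} = rprob F p E"
proof -
  interpret prob_space "site_measure p" by (rule prob_space_site_measure)
  let ?I = "{A. A \<subseteq> F \<and> E A}"
  have fin: "finite ?I" using assms(1) by simp
  have eq: "{\<omega>. E (Collect \<omega> \<inter> F)} = (\<Union>A\<in>?I. {\<omega>. Collect \<omega> \<inter> F = A})" by auto
  show "{\<omega>. E (Collect \<omega> \<inter> F)} \<in> sets (site_measure p)"
    unfolding eq using fin assms by (intro sets.finite_UN site_measure_atom) auto
  have "measure (site_measure p) {\<omega>. E (Collect \<omega> \<inter> F)}
      = (\<Sum>A\<in>?I. measure (site_measure p) {\<omega>. Collect \<omega> \<inter> F = A})"
    unfolding eq using fin assms
    by (intro finite_measure_finite_Union) (auto intro!: site_measure_atom simp: disjoint_family_on_def)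
  also have "\<dots> = (\<Sum>A\<in>?I. pmf (random_subset F p) A)"
    using assms by (intro sum.cong) (auto simp: site_measure_atom measure_pmf_single)
  also have "\<dots> = rprob F p (\<lambda>X. X \<in> ?I)"
    using fin by (simp add: measure_measure_pmf_finite)
  also have "\<dots> = rprob F p E"
    using assms by (intro rprob_cong) auto
  finally show "measure (site_measure p) {\<omega>. E (Collect \<omega> \<inter> F)} = rprob F p E" .
qed

text \<open>\<open>E\<close> need not be measurable: \<^const>\<open>measure\<close> vanishes on non-measurable sets.\<close>
lemma site_measure_le_rprob:
  assumes "finite F" "0 \<le> p" "p \<le> 1" "\<And>\<omega>. E \<omega> \<Longrightarrow> Q (Collect \<omega> \<inter> F)"
  shows "measure (site_measure p) {\<omega>. E \<omega>} \<le> rprob F p Q"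
proof -
  interpret prob_space "site_measure p" by (rule prob_space_site_measure)
  have "measure (site_measure p) {\<omega>. E \<omega>} \<le> measure (site_measure p) {\<omega>. Q (Collect \<omega> \<inter> F)}"
    using assms by (intro finite_measure_mono site_measure_finite_event) auto
  thus ?thesis using site_measure_finite_event(2)[OF assms(1-3), of Q] by simp
qed

section \<open>The line growth dynamics\<close>

text \<open>Lines are oriented: \<open>d = True\<close> stands for rows and \<open>d = False\<close> for columns. The
  \<open>d\<close>-line through \<open>z\<close> has the coordinate \<open>crd d z\<close>, and \<open>crd (\<not> d) z\<close> is the position of
  \<open>z\<close> on this line.\<close>

definition crd :: "bool \<Rightarrow> int \<times> int \<Rightarrow> int" where
  "crd d z = (if d then snd z else fst z)"

definition site :: "bool \<Rightarrow> int \<Rightarrow> int \<Rightarrow> int \<times> int" where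
  "site d c x = (if d then (x, c) else (c, x))"

definition Z2 :: "(nat \<times> nat) set" where
  "Z2 = {0, 1} \<times> {0, 1}"

declare split_paired_All [simp del] split_paired_Ex [simp del]

lemma crd_site [simp]: "crd d (site d c x) = c" "crd (\<not> d) (site d c x) = x"
  by (auto simp: crd_def site_def)

lemma crd_site' [simp]: "crd d (site (\<not> d) c x) = x"
  by (auto simp: crd_def site_def)

lemma site_crd [simp]: "site d (crd d z) (crd (\<not> d) z) = z"
  by (auto simp: crd_def site_def)

lemma site_not: "site (\<not> d) c x = site d x c"
  by (auto simp: site_def)

lemma site_eqI: "crd d z = crd d w \<Longrightarrow> crd (\<not> d) z = crd (\<not> d) w \<Longrightarrow> z = w"
  by (metis site_crd)

lemma site_eq_iff [simp]: "site d c x = site d c' x' \<longleftrightarrow> c = c' \<and> x = x'"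
  by (auto simp: site_def)

definition segment :: "int \<Rightarrow> bool \<Rightarrow> int \<times> int \<Rightarrow> (int \<times> int) set" where
  "segment r d z = {v. crd d v = crd d z \<and> \<bar>crd (\<not> d) v - crd (\<not> d) z\<bar> \<le> r}"

lemma nbhd_h_eq: "nbhd_h r z = segment r True z"
proof (intro set_eqI iffI)
  fix v assume "v \<in> segment r True z"
  thus "v \<in> nbhd_h r z"
    unfolding nbhd_h_def
    by (intro image_eqI[where x = "fst v - fst z"]) (auto simp: segment_def crd_def prod_eq_iff)
qed (auto simp: nbhd_h_def segment_def crd_def)

lemma nbhd_v_eq: "nbhd_v r z = segment r False z"
proof (intro set_eqI iffI)
  fix v assume "v \<in> segment r False z"
  thus "v \<in> nbhd_v r z"
    unfolding nbhd_v_def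
    by (intro image_eqI[where x = "snd v - snd z"]) (auto simp: segment_def crd_def prod_eq_iff)
qed (auto simp: nbhd_v_def segment_def crd_def)

lemma finite_segment: "finite (segment r d z)"
  by (cases d) (simp_all add: nbhd_h_eq[symmetric] nbhd_v_eq[symmetric] nbhd_h_def nbhd_v_def)

text \<open>A pair of counts lies outside the zero-set iff one of them is at least 2. From here on
  the dynamics is handled through two distinct occupied sites instead of cardinalities.\<close>

lemma growth_step_Z2:
  "z \<in> growth_step \<Lambda> r Z2 \<xi> \<longleftrightarrow> z \<in> \<xi> \<or> z \<in> \<Lambda> \<and>
    (\<exists>d. \<exists>v\<in>\<xi> \<inter> segment r d z. \<exists>w\<in>\<xi> \<inter> segment r d z. v \<noteq> w)"
proof -
  have *: "card (segment r d z \<inter> \<xi>) \<notin> {0, 1} \<longleftrightarrow>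
      (\<exists>v\<in>\<xi> \<inter> segment r d z. \<exists>w\<in>\<xi> \<inter> segment r d z. v \<noteq> w)" for d
  proof -
    have "card (segment r d z \<inter> \<xi>) \<notin> {0, 1} \<longleftrightarrow> \<not> card (segment r d z \<inter> \<xi>) \<le> Suc 0" by auto
    also have "\<dots> \<longleftrightarrow> (\<exists>v\<in>\<xi> \<inter> segment r d z. \<exists>w\<in>\<xi> \<inter> segment r d z. v \<noteq> w)"
      by (subst card_le_Suc0_iff_eq) (simp add: finite_segment, blast)
    finally show ?thesis .
  qed
  have "z \<in> growth_step \<Lambda> r Z2 \<xi> \<longleftrightarrow> z \<in> \<xi> \<or> z \<in> \<Lambda> \<and> (card (segment r True z \<inter> \<xi>) \<notin> {0, 1}
      \<or> card (segment r False z \<inter> \<xi>) \<notin> {0, 1})"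
    unfolding growth_step_def nbhd_h_eq nbhd_v_eq Z2_def by blast
  also have "\<dots> \<longleftrightarrow> z \<in> \<xi> \<or> z \<in> \<Lambda> \<and> (\<exists>d. card (segment r d z \<inter> \<xi>) \<notin> {0, 1})"
    by (metis (full_types))
  finally show ?thesis unfolding * .
qed

lemma growth_0 [simp]: "growth \<Lambda> r Z \<xi> 0 = \<xi>"
  by (simp add: growth_def)

lemma growth_Suc: "growth \<Lambda> r Z \<xi> (Suc t) = growth_step \<Lambda> r Z (growth \<Lambda> r Z \<xi> t)"
  by (simp add: growth_def)

lemma growth_le: "s \<le> t \<Longrightarrow> growth \<Lambda> r Z \<xi> s \<subseteq> growth \<Lambda> r Z \<xi> t"
  by (induction t) (auto simp: growth_Suc growth_step_def le_Suc_eq)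

lemma growth_subset: "\<xi> \<subseteq> \<Lambda> \<Longrightarrow> growth \<Lambda> r Z \<xi> t \<subseteq> \<Lambda>"
  by (induction t) (auto simp: growth_Suc growth_step_def)

lemma growth_SucI:
  assumes "z \<in> \<Lambda>" "v \<in> growth \<Lambda> r Z2 \<xi> t" "w \<in> growth \<Lambda> r Z2 \<xi> t"
    "v \<in> segment r d z" "w \<in> segment r d z" "v \<noteq> w"
  shows "z \<in> growth \<Lambda> r Z2 \<xi> (Suc t)"
proof -
  have "\<exists>d. \<exists>v\<in>growth \<Lambda> r Z2 \<xi> t \<inter> segment r d z. \<exists>w\<in>growth \<Lambda> r Z2 \<xi> t \<inter> segment r d z. v \<noteq> w"
    using assms(2-6) by (intro exI[of _ d] bexI[of _ v] bexI[of _ w] IntI)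
  thus ?thesis unfolding growth_Suc growth_step_Z2 using assms(1) by (intro disjI2 conjI)
qed

lemma growth_SucE:
  assumes "z \<in> growth \<Lambda> r Z2 \<xi> (Suc t)"
  obtains (old) "z \<in> growth \<Lambda> r Z2 \<xi> t"
  | (new) d v w where "z \<in> \<Lambda>" "v \<in> growth \<Lambda> r Z2 \<xi> t" "w \<in> growth \<Lambda> r Z2 \<xi> t"
      "v \<in> segment r d z" "w \<in> segment r d z" "v \<noteq> w"
  using assms unfolding growth_Suc growth_step_Z2 by (elim disjE conjE exE bexE IntE) metis+

lemma growth_mono:
  assumes "\<Lambda> \<subseteq> \<Lambda>'" "\<xi> \<subseteq> \<xi>'"
  shows "growth \<Lambda> r Z2 \<xi> t \<subseteq> growth \<Lambda>' r Z2 \<xi>' t"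
proof (induction t)
  case (Suc t)
  show ?case
  proof
    fix z assume "z \<in> growth \<Lambda> r Z2 \<xi> (Suc t)"
    thus "z \<in> growth \<Lambda>' r Z2 \<xi>' (Suc t)"
    proof (cases rule: growth_SucE)
      case old
      thus ?thesis using Suc.IH growth_le[of t "Suc t"] by (meson le_SucI order_refl subsetD)
    next
      case (new d v w)
      have "z \<in> \<Lambda>'" "v \<in> growth \<Lambda>' r Z2 \<xi>' t" "w \<in> growth \<Lambda>' r Z2 \<xi>' t"
        using new(1-3) Suc.IH assms(1) by (simp_all add: subset_iff)
      thus ?thesis by (rule growth_SucI) (rule new)+
    qed
  qed
qed (use assms in simp)

lemma enat_INF_attained:
  assumes "S \<noteq> {}"
  obtains n where "n \<in> S" "(INF n\<in>S. enat n) = enat n" "\<And>m. m \<in> S \<Longrightarrow> n \<le> m"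
proof
  let ?n = "LEAST n. n \<in> S"
  show "?n \<in> S" using assms LeastI_ex[of "\<lambda>n. n \<in> S"] by auto
  show *: "?n \<le> m" if "m \<in> S" for m using that by (rule Least_le)
  show "(INF n\<in>S. enat n) = enat ?n"
    using \<open>?n \<in> S\<close> * by (intro antisym INF_lower INF_greatest) auto
qed

subsection \<open>Growth in a box\<close>

lemma lattice_box_iff: "z \<in> lattice_box n \<longleftrightarrow> (\<forall>d. 0 \<le> crd d z \<and> crd d z < int n)"
  by (cases z) (auto simp: lattice_box_def crd_def)

lemma site_in_box: "site d c x \<in> lattice_box n \<longleftrightarrow> 0 \<le> c \<and> c < int n \<and> 0 \<le> x \<and> x < int n"
  by (auto simp: lattice_box_def site_def)

lemma finite_lattice_box: "finite (lattice_box n)"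
  by (simp add: lattice_box_def)

lemma card_lattice_box: "card (lattice_box n) = n * n"
  by (simp add: lattice_box_def)

context
  fixes r :: int and n :: nat and X :: "(int \<times> int) set"
  assumes r: "r \<ge> 2" and X: "X \<subseteq> lattice_box n"
begin

abbreviation \<xi> where "\<xi> \<equiv> growth (lattice_box n) r Z2 X"

definition full where
  "full d c t \<longleftrightarrow> {z \<in> lattice_box n. crd d z = c} \<subseteq> \<xi> t"

lemma full_mono: "full d c s \<Longrightarrow> s \<le> t \<Longrightarrow> full d c t"
  using growth_le[of s t "lattice_box n" r Z2 X] by (auto simp: full_def)

text \<open>Since r is at least 2, the next site on either side sees the two outermost sites of the
  occupied interval, which therefore grows by one at both ends in every step.\<close>

lemma full_of_adjacent:
  assumes "site d c x \<in> \<xi> t" "site d c (x + 1) \<in> \<xi> t"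
  shows "full d c (t + n)"
proof -
  have box: "site d c x \<in> lattice_box n" "site d c (x + 1) \<in> lattice_box n"
    using assms growth_subset[OF X] by blast+
  have *: "site d c y \<in> \<xi> (t + k)"
    if "x - int k \<le> y" "y \<le> x + 1 + int k" "0 \<le> y" "y < int n" for k y
    using that
  proof (induction k arbitrary: y)
    case 0
    hence "y = x \<or> y = x + 1" by auto
    thus ?case using assms by auto
  next
    case (Suc k)
    have y_box: "site d c y \<in> lattice_box n" using Suc.prems box by (auto simp: site_in_box)
    consider "x - int k \<le> y \<and> y \<le> x + 1 + int k" | "y = x - int k - 1" | "y = x + 2 + int k"
      using Suc.prems by linarith
    thus ?case
    proof cases
      case 1
      thus ?thesis using Suc growth_le[of "t + k" "t + Suc k" "lattice_box n" r Z2 X] by auto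
    next
      case 2
      have "site d c (y + 1) \<in> \<xi> (t + k)" "site d c (y + 2) \<in> \<xi> (t + k)"
        using 2 Suc.prems box by (auto intro!: Suc.IH simp: site_in_box)
      hence "site d c y \<in> \<xi> (Suc (t + k))"
        by (rule growth_SucI[OF y_box, where d = d]) (use r in \<open>auto simp: segment_def\<close>)
      thus ?thesis by simp
    next
      case 3
      have "site d c (y - 1) \<in> \<xi> (t + k)" "site d c (y - 2) \<in> \<xi> (t + k)"
        using 3 Suc.prems box by (auto intro!: Suc.IH simp: site_in_box)
      hence "site d c y \<in> \<xi> (Suc (t + k))"
        by (rule growth_SucI[OF y_box, where d = d]) (use r in \<open>auto simp: segment_def\<close>)
      thus ?thesis by simp
    qed
  qed
  show ?thesis
    unfolding full_def
  proof safe
    fix z assume z: "z \<in> lattice_box n" "c = crd d z"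
    have "z = site d c (crd (\<not> d) z)" using z by simp
    moreover have "site d c (crd (\<not> d) z) \<in> \<xi> (t + n)"
    proof (rule *)
      have "0 \<le> crd (\<not> d) z" "crd (\<not> d) z < int n"
        using z(1) unfolding lattice_box_iff by blast+
      thus "x - int n \<le> crd (\<not> d) z" "crd (\<not> d) z \<le> x + 1 + int n"
        "0 \<le> crd (\<not> d) z" "crd (\<not> d) z < int n"
        using box by (auto simp: site_in_box)
    qed
    ultimately show "z \<in> \<xi> (t + n)" by simp
  qed
qed

text \<open>The site in between sees both. Distance 2 occurs because initial pairs and reached lines
  have even coordinates.\<close>

lemma full_of_distance_2:
  assumes "site d c x \<in> \<xi> t" "site d c (x + 2) \<in> \<xi> t"
  shows "full d c (t + 1 + n)"
proof -
  have box: "site d c x \<in> lattice_box n" "site d c (x + 2) \<in> lattice_box n"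
    using assms growth_subset[OF X] by blast+
  hence "site d c (x + 1) \<in> lattice_box n" by (auto simp: site_in_box)
  hence "site d c (x + 1) \<in> \<xi> (Suc t)"
    using assms by (rule growth_SucI[where d = d]) (use r in \<open>auto simp: segment_def\<close>)
  moreover have "site d c x \<in> \<xi> (Suc t)"
    using assms(1) growth_le[of t "Suc t" "lattice_box n" r Z2 X] by auto
  ultimately show ?thesis using full_of_adjacent[of d c x "Suc t"] by simp
qed

lemma full_spawn:
  assumes "full d c t" "site d (c + 1) x \<in> X" "0 \<le> c"
  shows "full (\<not> d) x (t + n)"
proof -
  have "site d (c + 1) x \<in> lattice_box n" using assms(2) X by blast
  hence "site d c x \<in> \<xi> t" using assms(1,3) by (auto simp: full_def site_in_box)
  moreover have "site d (c + 1) x \<in> \<xi> t"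
    using assms(2) growth_le[of 0 t "lattice_box n" r Z2 X] by auto
  ultimately show ?thesis
    using full_of_adjacent[of "\<not> d" x c t] by (simp add: site_not)
qed

lemma box_filled:
  assumes "full d c t" "full d (c + 2) t" "0 \<le> c" "c + 2 < int n"
  shows "lattice_box n \<subseteq> \<xi> (t + 1 + n)"
proof
  fix z assume z: "z \<in> lattice_box n"
  define x where "x = crd (\<not> d) z"
  have "0 \<le> crd (\<not> d) z" "crd (\<not> d) z < int n" using z unfolding lattice_box_iff by blast+
  hence x: "0 \<le> x" "x < int n" by (simp_all add: x_def)
  have "site d c x \<in> \<xi> t" "site d (c + 2) x \<in> \<xi> t"
    using assms x by (auto simp: full_def site_in_box)
  hence "full (\<not> d) x (t + 1 + n)"
    using full_of_distance_2[of "\<not> d" x c t] by (simp add: site_not)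
  thus "z \<in> \<xi> (t + 1 + n)" using z by (auto simp: full_def x_def)
qed

end

subsection \<open>A directed bipartite graph on the even rows and columns\<close>

text \<open>If the \<open>d\<close>-line with coordinate \<open>2 i\<close> is full, then an occupied site \<open>edge d i j\<close> fills the
  perpendicular line with coordinate \<open>2 j\<close>. All these sites are distinct, and no coordinate pair of
  them is even-even, which leaves the even-even sites for nucleation.\<close>

definition edge :: "bool \<Rightarrow> nat \<Rightarrow> nat \<Rightarrow> int \<times> int" where
  "edge d i j = site d (2 * int i + 1) (2 * int j)"

definition even_site :: "nat \<Rightarrow> nat \<Rightarrow> int \<times> int" where
  "even_site i k = site True (2 * int i) (2 * int k)"

text \<open>Breadth-first exploration from row \<open>i\<close>. The direction alternates because a
  full row fills columns and conversely; one generation takes the time of one crossing of the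
  box.\<close>

fun reached :: "nat \<Rightarrow> (int \<times> int) set \<Rightarrow> nat \<Rightarrow> nat \<Rightarrow> bool \<Rightarrow> nat set" where
  "reached N X i 0 d = (if d then {i} else {})"
| "reached N X i (Suc g) d =
     reached N X i g d \<union> {j. j < N \<and> (\<exists>l \<in> reached N X i g (\<not> d). edge (\<not> d) l j \<in> X)}"

lemma reached_mono: "g \<le> h \<Longrightarrow> reached N X i g d \<subseteq> reached N X i h d"
  by (induction h) (auto simp: le_Suc_eq)

lemma reached_bound: "i < N \<Longrightarrow> reached N X i g d \<subseteq> {..<N}"
  by (induction g arbitrary: d) auto

lemma finite_reached: "i < N \<Longrightarrow> finite (reached N X i g d)"
  by (rule finite_subset[OF reached_bound]) auto

lemma reached_source:
  assumes "j \<in> reached N X i g d" "\<not> (d \<and> j = i)"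
  shows "\<exists>l \<in> reached N X i g (\<not> d). edge (\<not> d) l j \<in> X"
  using assms
proof (induction g)
  case 0
  thus ?case by (auto split: if_splits)
next
  case (Suc g)
  thus ?case using reached_mono[of g "Suc g" N X i "\<not> d"] by auto
qed

lemma reached_start: "i \<in> reached N X i g True"
  using reached_mono[of 0 g N X i True] by auto

text \<open>Pigeonhole: otherwise \<open>S\<close> and its shift by one would be disjoint subsets of
  {0..N}, which has N + 1 elements.\<close>

lemma consecutive_pair:
  assumes "S \<subseteq> {..<N}" "N + 1 < 2 * card S"
  obtains j where "j \<in> S" "Suc j \<in> S"
proof -
  have fin: "finite S" using finite_subset[OF assms(1)] by simp
  have "S \<inter> Suc ` S \<noteq> {}"
  proof
    assume "S \<inter> Suc ` S = {}"
    hence "card (S \<union> Suc ` S) = 2 * card S"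
      using fin by (simp add: card_Un_disjoint card_image)
    moreover have "card (S \<union> Suc ` S) \<le> card {..N}"
      using assms(1) by (intro card_mono) auto
    ultimately show False using assms(2) by simp
  qed
  thus ?thesis using that by blast
qed

lemma reached_full:
  assumes r: "r \<ge> 2" and X: "X \<subseteq> lattice_box (2 * N)" and i: "i < N"
    and seed: "even_site i (2 * k) \<in> X" "even_site i (2 * k + 1) \<in> X"
    and j: "j \<in> reached N X i g d"
  shows "full r (2 * N) X d (2 * int j) (1 + 2 * N + g * (2 * N))"
  using j
proof (induction g arbitrary: d j)
  case 0
  hence d: "d" "j = i" by (auto split: if_splits)
  \<comment> \<open>The sites of the initial pair have positions 4k and 4k + 2 on their row.\<close>
  have "full r (2 * N) X True (2 * int i) (0 + 1 + 2 * N)"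
    using seed by (intro full_of_distance_2[OF r X, of True _ "4 * int k"])
      (auto simp: even_site_def algebra_simps)
  thus ?case using d by simp
next
  case (Suc g)
  show ?case
  proof (cases "j \<in> reached N X i g d")
    case True
    show ?thesis by (rule full_mono[OF r X Suc.IH[OF True]]) simp
  next
    case False
    then obtain l where l: "l \<in> reached N X i g (\<not> d)" "edge (\<not> d) l j \<in> X"
      using Suc.prems by auto
    have "full r (2 * N) X (\<not> \<not> d) (2 * int j) (1 + 2 * N + g * (2 * N) + 2 * N)"
      using l(2) by (intro full_spawn[OF r X Suc.IH[OF l(1)]]) (auto simp: edge_def)
    thus ?thesis by (simp add: algebra_simps)
  qed
qed

lemma reached_fills_box:
  assumes r: "r \<ge> 2" and X: "X \<subseteq> lattice_box (2 * N)" and i: "i < N"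
    and seed: "even_site i (2 * k) \<in> X" "even_site i (2 * k + 1) \<in> X"
    and large: "N + 1 < 2 * card (reached N X i g d)"
  shows "lattice_box (2 * N) \<subseteq> growth (lattice_box (2 * N)) r Z2 X ((g + 2) * (2 * N + 1))"
proof -
  obtain j where j: "j \<in> reached N X i g d" "Suc j \<in> reached N X i g d"
    using consecutive_pair[OF reached_bound[OF i] large] .
  have "Suc j < N" using j(2) reached_bound[OF i] by blast
  let ?t = "1 + 2 * N + g * (2 * N)"
  have "lattice_box (2 * N) \<subseteq> growth (lattice_box (2 * N)) r Z2 X (?t + 1 + 2 * N)"
    using reached_full[OF r X i seed j(1)] reached_full[OF r X i seed j(2)] \<open>Suc j < N\<close>
    by (intro box_filled[OF r X, of d "2 * int j"]) (auto simp: algebra_simps)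
  also have "\<dots> \<subseteq> growth (lattice_box (2 * N)) r Z2 X ((g + 2) * (2 * N + 1))"
    by (rule growth_le) (simp add: algebra_simps)
  finally show ?thesis .
qed

text \<open>If each of the first \<open>G\<close> steps more than doubled the total number of
  reached lines, this number would be at least 2^G > N + 1, whereas two sets of at most (N + 1)/2
  elements have at most N + 1 together. By monotonicity the sets are small after every earlier step
  as well.\<close>

lemma stalled_step:
  assumes i: "i < N" and G: "N + 1 < 2 ^ G"
    and small: "\<And>d. 2 * card (reached N X i G d) \<le> N + 1"
  obtains g where "g < G"
    "card (reached N X i (Suc g) True) + card (reached N X i (Suc g) False)
      \<le> 2 * (card (reached N X i g True) + card (reached N X i g False))"
    "\<And>d. 2 * card (reached N X i (Suc g) d) \<le> N + 1"
proof -
  define c where "c g = card (reached N X i g True) + card (reached N X i g False)" for g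
  have "\<exists>g<G. c (Suc g) \<le> 2 * c g"
  proof (rule ccontr)
    assume "\<not> ?thesis"
    hence *: "2 * c g < c (Suc g)" if "g < G" for g using that by (meson not_le)
    have "2 ^ g \<le> c g" if "g \<le> G" for g
      using that
    proof (induction g)
      case 0
      show ?case by (simp add: c_def)
    next
      case (Suc g)
      thus ?case using *[of g] by simp
    qed
    hence "2 ^ G \<le> c G" by simp
    moreover have "c G \<le> N + 1" using small[of True] small[of False] by (simp add: c_def)
    ultimately show False using G by simp
  qed
  then obtain g where g: "g < G" "c (Suc g) \<le> 2 * c g" by blast
  moreover have "2 * card (reached N X i (Suc g) d) \<le> N + 1" for d
  proof -
    have "card (reached N X i (Suc g) d) \<le> card (reached N X i G d)"
      using g(1) by (intro card_mono finite_reached[OF i] reached_mono) simp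
    thus ?thesis using small[of d] by simp
  qed
  ultimately show ?thesis using that unfolding c_def by blast
qed

section \<open>The reached set covers more than half of the lines\<close>

lemma edge_eq_iff [simp]: "edge d i j = edge d' i' j' \<longleftrightarrow> d = d' \<and> i = i' \<and> j = j'"
  by (cases d; cases d') (simp_all add: edge_def site_def; presburger)+

lemma even_site_eq_iff [simp]: "even_site i k = even_site i' k' \<longleftrightarrow> i = i' \<and> k = k'"
  by (auto simp: even_site_def)

lemma edge_neq_even_site [simp]: "edge d i j \<noteq> even_site l k" "even_site l k \<noteq> edge d i j"
  by (cases d; simp add: edge_def even_site_def site_def; presburger)+

lemma edge_in_box: "edge d i j \<in> lattice_box (2 * N) \<longleftrightarrow> i < N \<and> j < N"
  by (auto simp: edge_def site_in_box)

lemma even_site_in_box: "even_site i k \<in> lattice_box (2 * N) \<longleftrightarrow> i < N \<and> k < N"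
  by (auto simp: even_site_def site_in_box)

text \<open>A step of \<^const>\<open>reached\<close> that fails to double is witnessed by finite data whose probability is
  small: \<open>insert i S\<close> and \<open>T\<close> are the rows and columns reached after the step, \<open>S\<^sub>0\<close> and \<open>T\<^sub>0\<close>
  those reached before it, and \<open>f\<close> and \<open>h\<close> select an edge into every reached line except \<open>i\<close>.\<close>

definition occupied_sites ::
    "nat \<Rightarrow> nat \<Rightarrow> nat set \<Rightarrow> nat set \<Rightarrow> (nat \<Rightarrow> nat) \<Rightarrow> (nat \<Rightarrow> nat) \<Rightarrow> (int \<times> int) set" where
  "occupied_sites i k S T f h = {even_site i (2 * k), even_site i (2 * k + 1)}
     \<union> (\<lambda>j. edge True (f j) j) ` T \<union> (\<lambda>l. edge False (h l) l) ` S"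

definition empty_sites ::
    "nat \<Rightarrow> nat \<Rightarrow> nat set \<Rightarrow> nat set \<Rightarrow> nat set \<Rightarrow> nat set \<Rightarrow> (int \<times> int) set" where
  "empty_sites N i S T S\<^sub>0 T\<^sub>0 = (\<lambda>(l, j). edge True l j) ` (S\<^sub>0 \<times> ({..<N} - T))
     \<union> (\<lambda>(j, l). edge False j l) ` (T\<^sub>0 \<times> ({..<N} - insert i S))"

text \<open>The inequality is the failure to double; its \<open>Suc\<close> counts the root
  \<open>i\<close>, which \<open>stalled\<close> keeps out of \<open>S\<close>. The selections
  \<open>f\<close> and \<open>h\<close> range over all functions and not only over those that
  describe a tree, which makes them easy to count.\<close>

definition stall_data ::
    "nat \<Rightarrow> nat set \<Rightarrow> nat set \<Rightarrow> (nat set \<times> nat set \<times> (nat \<Rightarrow> nat) \<times> (nat \<Rightarrow> nat)) set" where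
  "stall_data i S T = {D \<in> Pow (insert i S) \<times> Pow T \<times> (T \<rightarrow>\<^sub>E insert i S) \<times> (S \<rightarrow>\<^sub>E T).
     Suc (card S) + card T \<le> 2 * (card (fst D) + card (fst (snd D)))}"

definition stalled :: "nat \<Rightarrow> nat \<Rightarrow> nat \<Rightarrow> (int \<times> int) set \<Rightarrow> bool" where
  "stalled N i k X \<longleftrightarrow> (\<exists>S\<in>Pow ({..<N} - {i}). \<exists>T\<in>Pow {..<N}.
     2 * Suc (card S) \<le> N + 1 \<and> 2 * card T \<le> N + 1 \<and>
     (\<exists>D\<in>stall_data i S T. case D of (S\<^sub>0, T\<^sub>0, f, h) \<Rightarrow>
        occupied_sites i k S T f h \<subseteq> X \<and> empty_sites N i S T S\<^sub>0 T\<^sub>0 \<inter> X = {}))"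

text \<open>Every reached line except the root has an edge from a reached line, which defines
  \<open>f\<close> and \<open>h\<close>. A line not reached after the step has no edge from a line
  reached before it, which gives the empty sites.\<close>

lemma stalled_if_not_large:
  assumes i: "i < N" and G: "N + 1 < 2 ^ G"
    and small: "\<And>d. 2 * card (reached N X i G d) \<le> N + 1"
    and seed: "even_site i (2 * k) \<in> X" "even_site i (2 * k + 1) \<in> X"
  shows "stalled N i k X"
proof -
  obtain g where g: "g < G"
    "card (reached N X i (Suc g) True) + card (reached N X i (Suc g) False)
      \<le> 2 * (card (reached N X i g True) + card (reached N X i g False))"
    "\<And>d. 2 * card (reached N X i (Suc g) d) \<le> N + 1"
    using stalled_step[OF i G small] by metis
  define R where "R = reached N X i (Suc g)"
  define S\<^sub>0 where "S\<^sub>0 = reached N X i g True"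
  define T\<^sub>0 where "T\<^sub>0 = reached N X i g False"
  define S where "S = R True - {i}"
  define T where "T = R False"
  have fin: "finite (R d)" for d unfolding R_def by (rule finite_reached[OF i])
  have bound: "R d \<subseteq> {..<N}" for d unfolding R_def by (rule reached_bound[OF i])
  have S_eq: "insert i S = R True"
    using reached_start[of i N X "Suc g"] by (auto simp: S_def R_def)
  have card_S: "Suc (card S) = card (R True)"
    using fin[of True] unfolding S_eq[symmetric] by (subst card_insert_disjoint) (auto simp: S_def)
  have sub: "S\<^sub>0 \<subseteq> insert i S" "T\<^sub>0 \<subseteq> T"
    unfolding S_eq by (auto simp: S\<^sub>0_def T\<^sub>0_def T_def R_def)
  \<comment> \<open>Restricting to \<open>T\<close> makes \<open>f\<close> extensional, so that it
    is an element of the finite set \<open>T \<rightarrow>\<^sub>E insert i S\<close>.\<close>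
  define f where "f = (\<lambda>j\<in>T. SOME l. l \<in> insert i S \<and> edge True l j \<in> X)"
  define h where "h = (\<lambda>l\<in>S. SOME j. j \<in> T \<and> edge False j l \<in> X)"
  have f: "f j \<in> insert i S" "edge True (f j) j \<in> X" if "j \<in> T" for j
  proof -
    have "\<exists>l. l \<in> insert i S \<and> edge True l j \<in> X"
      using reached_source[of j N X i "Suc g" False] that unfolding S_eq T_def R_def by auto
    from someI_ex[OF this] show "f j \<in> insert i S" "edge True (f j) j \<in> X"
      using that by (simp_all add: f_def)
  qed
  have h: "h l \<in> T" "edge False (h l) l \<in> X" if "l \<in> S" for l
  proof -
    have "\<exists>j. j \<in> T \<and> edge False j l \<in> X"
      using reached_source[of l N X i "Suc g" True] that unfolding S_def T_def R_def by auto
    from someI_ex[OF this] show "h l \<in> T" "edge False (h l) l \<in> X"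
      using that by (simp_all add: h_def)
  qed
  have D: "(S\<^sub>0, T\<^sub>0, f, h) \<in> stall_data i S T"
    using sub f(1) h(1) g(2)
    by (auto simp: stall_data_def f_def h_def card_S S\<^sub>0_def T\<^sub>0_def T_def R_def simp del: reached.simps)
  have occ: "occupied_sites i k S T f h \<subseteq> X"
    using seed f(2) h(2) by (auto simp: occupied_sites_def)
  have no_edge: "edge True l j \<notin> X" if "l \<in> S\<^sub>0" "j < N" "j \<notin> T" for l j
    using that by (auto simp: S\<^sub>0_def T_def R_def)
  have no_edge': "edge False j l \<notin> X" if "j \<in> T\<^sub>0" "l < N" "l \<notin> insert i S" for l j
    using that unfolding S_eq by (auto simp: T\<^sub>0_def R_def)
  have emp: "empty_sites N i S T S\<^sub>0 T\<^sub>0 \<inter> X = {}"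
    by (auto simp: empty_sites_def no_edge dest: no_edge'[unfolded insert_iff])
  have "S \<in> Pow ({..<N} - {i})" "T \<in> Pow {..<N}" using bound by (auto simp: S_def T_def)
  moreover have "2 * Suc (card S) \<le> N + 1" "2 * card T \<le> N + 1"
    using g(3)[folded R_def] unfolding card_S T_def by blast+
  ultimately show ?thesis
    unfolding stalled_def using D occ emp by (intro bexI[of _ S] bexI[of _ T] conjI bexI[OF _ D]) auto
qed

lemma card_occupied_sites:
  assumes "finite S" "finite T"
  shows "card (occupied_sites i k S T f h) = 2 + card T + card S"
proof -
  have "card ((\<lambda>j. edge True (f j) j) ` T) = card T" "card ((\<lambda>l. edge False (h l) l) ` S) = card S"
    by (auto intro!: card_image simp: inj_on_def)
  moreover have "card ({even_site i (2 * k), even_site i (2 * k + 1)} \<union> (\<lambda>j. edge True (f j) j) ` T)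
      = 2 + card ((\<lambda>j. edge True (f j) j) ` T)"
    using assms(2) by (subst card_Un_disjoint) auto
  moreover have "card (occupied_sites i k S T f h)
      = card ({even_site i (2 * k), even_site i (2 * k + 1)} \<union> (\<lambda>j. edge True (f j) j) ` T)
        + card ((\<lambda>l. edge False (h l) l) ` S)"
    unfolding occupied_sites_def using assms by (intro card_Un_disjoint) auto
  ultimately show ?thesis by simp
qed

lemma card_empty_sites:
  assumes "finite S\<^sub>0" "finite T\<^sub>0"
  shows "card (empty_sites N i S T S\<^sub>0 T\<^sub>0)
    = card S\<^sub>0 * card ({..<N} - T) + card T\<^sub>0 * card ({..<N} - insert i S)"
proof -
  have "card ((\<lambda>(l, j). edge True l j) ` (S\<^sub>0 \<times> ({..<N} - T))) = card (S\<^sub>0 \<times> ({..<N} - T))"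
    "card ((\<lambda>(j, l). edge False j l) ` (T\<^sub>0 \<times> ({..<N} - insert i S)))
      = card (T\<^sub>0 \<times> ({..<N} - insert i S))"
    by (auto intro!: card_image simp: inj_on_def)
  thus ?thesis
    unfolding empty_sites_def using assms
    by (subst card_Un_disjoint) (auto simp: card_cartesian_product)
qed

text \<open>The occupied sites are the initial pair and one edge per element of \<open>S\<close> and
  \<open>T\<close>. Each line of \<open>S\<^sub>0\<close> or \<open>T\<^sub>0\<close> misses at
  least (N - 1)/2 lines, and since the step did not double there are at least (1 + |S| + |T|)/2 such
  lines; hence the 4 in the exponent.\<close>

lemma rprob_stall_data:
  assumes N: "i < N" "2 * k + 1 < N" and p: "0 \<le> p" "p \<le> 1"
    and S: "S \<subseteq> {..<N} - {i}" "2 * Suc (card S) \<le> N + 1" and T: "T \<subseteq> {..<N}" "2 * card T \<le> N + 1"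
    and D: "(S\<^sub>0, T\<^sub>0, f, h) \<in> stall_data i S T"
  shows "rprob (lattice_box (2 * N)) p
      (\<lambda>X. occupied_sites i k S T f h \<subseteq> X \<and> empty_sites N i S T S\<^sub>0 T\<^sub>0 \<inter> X = {})
    \<le> p ^ (2 + card S + card T) * exp (- p * (real N - 1) / 4) ^ (1 + card S + card T)"
proof -
  have fin: "finite S" "finite T" using S T by (auto intro: finite_subset)
  have D': "S\<^sub>0 \<subseteq> insert i S" "T\<^sub>0 \<subseteq> T" "f \<in> T \<rightarrow>\<^sub>E insert i S" "h \<in> S \<rightarrow>\<^sub>E T"
    "Suc (card S) + card T \<le> 2 * (card S\<^sub>0 + card T\<^sub>0)"
    using D by (auto simp: stall_data_def)
  have fin0: "finite S\<^sub>0" "finite T\<^sub>0" using D'(1,2) fin by (auto intro: finite_subset)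
  let ?e = "card (empty_sites N i S T S\<^sub>0 T\<^sub>0)"
  have f: "f j < N" if "j \<in> T" for j
  proof -
    have "f j \<in> insert i S" using D'(3) that by auto
    thus ?thesis using N(1) S(1) by auto
  qed
  have h: "h l < N" if "l \<in> S" for l
  proof -
    have "h l \<in> T" using D'(4) that by auto
    thus ?thesis using T(1) by auto
  qed
  have box: "occupied_sites i k S T f h \<subseteq> lattice_box (2 * N)"
    using N S(1) T(1) f h by (auto simp: occupied_sites_def edge_in_box even_site_in_box)
  have box': "empty_sites N i S T S\<^sub>0 T\<^sub>0 \<subseteq> lattice_box (2 * N)"
  proof -
    have "S\<^sub>0 \<subseteq> {..<N}" "T\<^sub>0 \<subseteq> {..<N}" using N(1) S(1) T(1) D'(1,2) by auto
    thus ?thesis by (auto simp: empty_sites_def edge_in_box)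
  qed
  have disj: "occupied_sites i k S T f h \<inter> empty_sites N i S T S\<^sub>0 T\<^sub>0 = {}"
    by (auto simp: occupied_sites_def empty_sites_def)
  have eq: "rprob (lattice_box (2 * N)) p
      (\<lambda>X. occupied_sites i k S T f h \<subseteq> X \<and> empty_sites N i S T S\<^sub>0 T\<^sub>0 \<inter> X = {})
    = p ^ (2 + card S + card T) * (1 - p) ^ ?e"
    using rprob_cylinder[OF finite_lattice_box box box' disj p]
    unfolding card_occupied_sites[OF fin] by (simp add: add_ac)
  have "real (card ({..<N} - T)) = real N - real (card T)"
    using T(1) card_mono[OF _ T(1)] by (subst card_Diff_subset) (auto simp: fin)
  hence 1: "2 * real (card ({..<N} - T)) \<ge> real N - 1" using T(2) by linarith
  have card_iS: "card (insert i S) = Suc (card S)"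
    using S(1) fin by (subst card_insert_disjoint) auto
  have iS: "insert i S \<subseteq> {..<N}" using N(1) S(1) by auto
  have card_diff: "real (card ({..<N} - insert i S)) = real N - real (Suc (card S))"
    using card_mono[OF _ iS] iS by (subst card_Diff_subset) (auto simp: fin card_iS)
  have 2: "2 * real (card ({..<N} - insert i S)) \<ge> real N - 1"
    unfolding card_diff using of_nat_mono[OF S(2), where ?'a = real] by simp
  have N1: "real N - 1 \<ge> 0" using N(1) by linarith
  have "real (1 + card S + card T) * (real N - 1) \<le> 2 * (real (card S\<^sub>0) + real (card T\<^sub>0)) * (real N - 1)"
    using of_nat_mono[OF D'(5), where ?'a = real] N1 by (intro mult_right_mono) simp_all
  also have "\<dots> = 2 * (real (card S\<^sub>0) * (real N - 1) + real (card T\<^sub>0) * (real N - 1))"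
    by (simp add: algebra_simps)
  also have "\<dots> \<le> 2 * (real (card S\<^sub>0) * (2 * real (card ({..<N} - T)))
      + real (card T\<^sub>0) * (2 * real (card ({..<N} - insert i S))))"
    using 1 2 by (intro mult_left_mono add_mono) auto
  also have "\<dots> = 4 * real ?e" unfolding card_empty_sites[OF fin0] by simp
  finally have e: "real (1 + card S + card T) * (real N - 1) \<le> 4 * real ?e" .
  have "(1 - p) ^ ?e \<le> exp (- p) ^ ?e"
    using p exp_ge_add_one_self[of "- p"] by (intro power_mono) auto
  also have "\<dots> = exp (- p * real ?e)" by (simp add: exp_of_nat_mult[symmetric] mult.commute)
  also have "\<dots> \<le> exp (- p * (real (1 + card S + card T) * (real N - 1) / 4))"
  proof -
    have "real (1 + card S + card T) * (real N - 1) / 4 \<le> real ?e" using e by simp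
    from mult_left_mono[OF this p(1)] show ?thesis by simp
  qed
  also have "\<dots> = exp (- p * (real N - 1) / 4) ^ (1 + card S + card T)"
    unfolding exp_of_nat_mult[symmetric] by (simp add: algebra_simps)
  finally show ?thesis unfolding eq using p by (intro mult_left_mono) auto
qed

section \<open>The union bound over stalled steps\<close>

lemma card_stall_data:
  assumes "finite S" "finite T" "i \<notin> S"
  shows "finite (stall_data i S T)"
    and "card (stall_data i S T)
      \<le> 2 ^ (1 + card S + card T) * (1 + card S) ^ card T * card T ^ card S"
proof -
  let ?P = "Pow (insert i S) \<times> Pow T \<times> (T \<rightarrow>\<^sub>E insert i S) \<times> (S \<rightarrow>\<^sub>E T)"
  have fin: "finite ?P" using assms by (intro finite_cartesian_product finite_PiE) simp_all
  show "finite (stall_data i S T)" unfolding stall_data_def using fin by simp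
  have "card (stall_data i S T) \<le> card ?P"
    unfolding stall_data_def using fin by (intro card_mono) auto
  also have "\<dots> = 2 ^ (1 + card S + card T) * (1 + card S) ^ card T * card T ^ card S"
    using assms by (simp add: card_cartesian_product card_Pow card_PiE power_add)
  finally show "card (stall_data i S T)
      \<le> 2 ^ (1 + card S + card T) * (1 + card S) ^ card T * card T ^ card S" .
qed

lemma sum_Pow_card:
  fixes \<phi> :: "nat \<Rightarrow> real"
  assumes "finite U"
  shows "(\<Sum>S\<in>Pow U. \<phi> (card S)) = (\<Sum>a\<le>card U. real (card U choose a) * \<phi> a)"
proof -
  have "(\<Sum>S\<in>Pow U. \<phi> (card S)) = (\<Sum>a\<le>card U. \<Sum>S\<in>{S \<in> Pow U. card S = a}. \<phi> (card S))"
    using assms by (intro sum.group[symmetric]) (auto intro: card_mono)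
  also have "\<dots> = (\<Sum>a\<le>card U. real (card {S. S \<subseteq> U \<and> card S = a}) * \<phi> a)"
    by (intro sum.cong) auto
  finally show ?thesis using n_subsets[OF assms] by simp
qed

lemma power_div_fact_le_exp:
  assumes "0 \<le> (x::real)"
  shows "x ^ n / fact n \<le> exp x"
proof -
  have "(\<Sum>k<Suc n. x ^ k /\<^sub>R fact k) \<le> (\<Sum>k. x ^ k /\<^sub>R fact k)"
    using assms summable_exp_generic[of x] by (intro sum_le_suminf) (auto simp: divide_simps)
  moreover have "x ^ n /\<^sub>R fact n \<le> (\<Sum>k<Suc n. x ^ k /\<^sub>R fact k)"
    using assms by (intro member_le_sum) (auto simp: divide_simps)
  ultimately show ?thesis unfolding exp_def by (simp add: divide_inverse mult.commute)
qed

lemma choose_le_power_div_fact: "real (n choose a) \<le> real n ^ a / fact a"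
proof -
  have "real ((n choose a) * fact a) \<le> real (n ^ a)" by (subst of_nat_le_iff) (rule binomial_fact_pow)
  thus ?thesis by (simp add: field_simps)
qed

lemma sum_geometric_le:
  assumes "0 \<le> (y::real)" "y \<le> 1/2"
  shows "(\<Sum>a\<le>n. y ^ a) \<le> 2"
proof -
  have "(\<Sum>a\<le>n. y ^ a) \<le> (\<Sum>a. y ^ a)"
    using assms by (intro sum_le_suminf summable_geometric) auto
  also have "\<dots> = 1 / (1 - y)" using assms by (intro suminf_geometric) auto
  also have "\<dots> \<le> 2" using assms by (simp add: field_simps)
  finally show ?thesis .
qed

text \<open>With a = |S| and t = |T|, every unit of 1 + a + t contributes one factor
  \<open>y\<close>: 2 from the subsets, exp 1 from the selections divided by factorials, Np from a
  choice of line and its edge, and the exponential from the empty sites. A factor p/N of the initial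
  pair is left over.\<close>

lemma rprob_stalled:
  fixes p :: real and N :: nat
  defines "y \<equiv> 2 * exp 1 * (real N * p) * exp (- p * (real N - 1) / 4)"
  assumes N: "i < N" "2 * k + 1 < N" and p: "0 < p" "p \<le> 1" and y: "y \<le> 1/2"
  shows "rprob (lattice_box (2 * N)) p (stalled N i k) \<le> 4 * p * y / real N"
proof -
  define q where "q = exp (- p * (real N - 1) / 4)"
  define w where "w a t = real (2 ^ (1 + a + t) * (1 + a) ^ t * t ^ a) * (p ^ (2 + a + t) * q ^ (1 + a + t))" for a t
  have y_q: "y = 2 * exp 1 * (real N * p) * q" by (simp add: y_def q_def)
  have q: "q \<ge> 0" by (simp add: q_def)
  have y0: "y \<ge> 0" using p by (simp add: y_def)
  have w0: "w a t \<ge> 0" for a t using p q by (simp add: w_def)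
  let ?box = "lattice_box (2 * N)"
  have E_le: "rprob ?box p (\<lambda>X. 2 * Suc (card S) \<le> N + 1 \<and> 2 * card T \<le> N + 1 \<and>
     (\<exists>D\<in>stall_data i S T. case D of (S\<^sub>0, T\<^sub>0, f, h) \<Rightarrow>
        occupied_sites i k S T f h \<subseteq> X \<and> empty_sites N i S T S\<^sub>0 T\<^sub>0 \<inter> X = {})) \<le> w (card S) (card T)"
    (is "rprob ?box p (?E S T) \<le> _")
    if S: "S \<in> Pow ({..<N} - {i})" and T: "T \<in> Pow {..<N}" for S T
  proof (cases "2 * Suc (card S) \<le> N + 1 \<and> 2 * card T \<le> N + 1")
    case True
    have fin: "finite S" "finite T" "i \<notin> S" using S T by (auto intro: finite_subset)
    have "rprob ?box p (\<lambda>X. \<exists>D\<in>stall_data i S T. case D of (S\<^sub>0, T\<^sub>0, f, h) \<Rightarrow>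
        occupied_sites i k S T f h \<subseteq> X \<and> empty_sites N i S T S\<^sub>0 T\<^sub>0 \<inter> X = {})
      \<le> real (card (stall_data i S T)) * (p ^ (2 + card S + card T) * q ^ (1 + card S + card T))"
    proof (rule rprob_Bex_le[OF card_stall_data(1)[OF fin]])
      fix D assume D: "D \<in> stall_data i S T"
      obtain S\<^sub>0 T\<^sub>0 f h where D_eq: "D = (S\<^sub>0, T\<^sub>0, f, h)" by (cases D)
      show "rprob ?box p (\<lambda>X. case D of (S\<^sub>0, T\<^sub>0, f, h) \<Rightarrow>
        occupied_sites i k S T f h \<subseteq> X \<and> empty_sites N i S T S\<^sub>0 T\<^sub>0 \<inter> X = {})
        \<le> p ^ (2 + card S + card T) * q ^ (1 + card S + card T)"
        unfolding D_eq prod.case q_def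
        by (rule rprob_stall_data) (use N p S T True D in \<open>simp_all add: D_eq\<close>)
    qed
    also have "\<dots> \<le> w (card S) (card T)"
      unfolding w_def using card_stall_data(2)[OF fin] p q
      by (intro mult_right_mono of_nat_mono) auto
    finally show ?thesis using True by simp
  qed (use w0 in auto)
  have E_le': "rprob ?box p (\<lambda>X. \<exists>T\<in>Pow {..<N}. ?E S T X) \<le> (\<Sum>T\<in>Pow {..<N}. w (card S) (card T))"
    if "S \<in> Pow ({..<N} - {i})" for S
    by (rule order_trans[OF rprob_Bex sum_mono]) (use E_le[OF that] in simp_all)
  have "rprob ?box p (stalled N i k)
      \<le> (\<Sum>S\<in>Pow ({..<N} - {i}). \<Sum>T\<in>Pow {..<N}. w (card S) (card T))"
    unfolding stalled_def by (rule order_trans[OF rprob_Bex sum_mono]) (use E_le' in simp_all)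
  also have "\<dots> = (\<Sum>a\<le>N - 1. real (N - 1 choose a) * (\<Sum>t\<le>N. real (N choose t) * w a t))"
    using N(1) sum_Pow_card[of "{..<N}" "w a" for a]
      sum_Pow_card[of "{..<N} - {i}" "\<lambda>a. \<Sum>t\<le>N. real (N choose t) * w a t"] by simp
  also have "\<dots> = (\<Sum>a\<le>N - 1. \<Sum>t\<le>N. real (N - 1 choose a) * real (N choose t) * w a t)"
    by (simp add: sum_distrib_left mult.assoc)
  also have "\<dots> \<le> (\<Sum>a\<le>N - 1. \<Sum>t\<le>N. p / real N * y * (y ^ a * y ^ t))"
  proof (intro sum_mono)
    fix a t
    have "real (N - 1 choose a) \<le> real (N - 1) ^ a / fact a" by (rule choose_le_power_div_fact)
    also have "\<dots> \<le> real N ^ a / fact a" by (intro divide_right_mono power_mono) auto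
    finally have "real (N - 1 choose a) * real (N choose t) * w a t
        \<le> (real N ^ a / fact a) * (real N ^ t / fact t) * w a t"
      using choose_le_power_div_fact[of N t] w0 by (intro mult_mono mult_right_mono) auto
    \<comment> \<open>The pairing is crossed: the selections on the t columns are divided by the t!
      of the choice of columns, those on the a rows by a!. Both quotients are then single terms of
      an exponential series.\<close>
    also have "\<dots> = (real (1 + a) ^ t / fact t) * (real t ^ a / fact a)
        * (real N ^ (a + t) * 2 ^ (1 + a + t) * (p ^ (2 + a + t) * q ^ (1 + a + t)))"
      by (simp add: w_def power_add mult_ac)
    also have "\<dots> \<le> (exp (real (1 + a)) * exp (real t))
        * (real N ^ (a + t) * 2 ^ (1 + a + t) * (p ^ (2 + a + t) * q ^ (1 + a + t)))"
      using p q by (intro mult_right_mono mult_mono power_div_fact_le_exp) auto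
    also have "exp (real (1 + a)) * exp (real t) = exp 1 ^ (1 + a + t)"
      by (simp add: exp_of_nat_mult[symmetric] exp_add[symmetric])
    also have "exp 1 ^ (1 + a + t) * (real N ^ (a + t) * 2 ^ (1 + a + t) * (p ^ (2 + a + t) * q ^ (1 + a + t)))
        = p / real N * y * (y ^ a * y ^ t)"
      using N(1) unfolding y_q by (simp add: power_add power_mult_distrib field_simps)
    finally show "real (N - 1 choose a) * real (N choose t) * w a t \<le> p / real N * y * (y ^ a * y ^ t)" .
  qed
  also have "\<dots> = p / real N * y * ((\<Sum>a\<le>N - 1. y ^ a) * (\<Sum>t\<le>N. y ^ t))"
    unfolding sum_product by (simp only: sum_distrib_left)
  also have "\<dots> \<le> p / real N * y * (2 * 2)"
    using p y y0 by (intro mult_left_mono mult_mono sum_geometric_le) (auto intro: sum_nonneg)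
  finally show ?thesis by (simp add: mult_ac)
qed

definition filled_by :: "int \<Rightarrow> nat \<Rightarrow> nat \<Rightarrow> (int \<times> int) set \<Rightarrow> bool" where
  "filled_by r n t X \<longleftrightarrow> lattice_box n \<subseteq> growth (lattice_box n) r Z2 (X \<inter> lattice_box n) t"

text \<open>Either none of the N (N div 2) disjoint initial pairs is occupied, or one is and its
  exploration stalls. As \<open>stalled\<close> includes the cost of the pair, the union bound over
  all pairs loses only a factor of order Np.\<close>

lemma rprob_not_filled:
  fixes p :: real and N :: nat
  defines "y \<equiv> 2 * exp 1 * (real N * p) * exp (- p * (real N - 1) / 4)"
  assumes r: "r \<ge> 2" and p: "0 < p" "p \<le> 1" and y: "y \<le> 1/2" and G: "N + 1 < 2 ^ G" and N: "N > 0"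
  shows "rprob (lattice_box (2 * N)) p (\<lambda>X. \<not> filled_by r (2 * N) ((G + 2) * (2 * N + 1)) X)
    \<le> (1 - p\<^sup>2) ^ (N * (N div 2)) + 2 * real N * p * y"
proof -
  let ?box = "lattice_box (2 * N)"
  let ?J = "{..<N} \<times> {..<N div 2}"
  let ?a = "\<lambda>(i, k). even_site i (2 * k)" and ?b = "\<lambda>(i, k). even_site i (2 * k + 1)"
  let ?none = "\<lambda>X. \<forall>j\<in>?J. \<not> (?a j \<in> X \<and> ?b j \<in> X)"
  have y0: "y \<ge> 0" using p by (simp add: y_def)
  have "rprob ?box p (\<lambda>X. \<not> filled_by r (2 * N) ((G + 2) * (2 * N + 1)) X)
      \<le> rprob ?box p (\<lambda>X. ?none X \<or> (\<exists>j\<in>?J. stalled N (fst j) (snd j) X))"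
  proof (rule rprob_mono[OF finite_lattice_box])
    fix X assume X: "X \<subseteq> ?box" and not: "\<not> filled_by r (2 * N) ((G + 2) * (2 * N + 1)) X"
    have "\<exists>j\<in>?J. stalled N (fst j) (snd j) X" if some: "\<not> ?none X"
    proof -
      obtain i k where ik: "i < N" "k < N div 2" "even_site i (2 * k) \<in> X" "even_site i (2 * k + 1) \<in> X"
        using some by auto
      have "2 * card (reached N X i G d) \<le> N + 1" for d
        using reached_fills_box[OF r X ik(1,3,4)] not X
        by (auto simp: filled_by_def Int_absorb2 not_le[symmetric])
      from stalled_if_not_large[OF ik(1) G this ik(3,4)] show ?thesis
        using ik(1,2) by (intro bexI[of _ "(i, k)"]) auto
    qed
    thus "?none X \<or> (\<exists>j\<in>?J. stalled N (fst j) (snd j) X)" by blast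
  qed
  also have "\<dots> \<le> rprob ?box p ?none + rprob ?box p (\<lambda>X. \<exists>j\<in>?J. stalled N (fst j) (snd j) X)"
    by (rule rprob_disj)
  also have "rprob ?box p ?none = (1 - p\<^sup>2) ^ card ?J"
  proof (rule rprob_no_pair[OF _ finite_lattice_box])
    show "?a ` ?J \<union> ?b ` ?J \<subseteq> ?box" by (auto simp: even_site_in_box)
    show "?a ` ?J \<inter> ?b ` ?J = {}" by auto presburger
  qed (use p in \<open>auto simp: inj_on_def\<close>)
  also have "rprob ?box p (\<lambda>X. \<exists>j\<in>?J. stalled N (fst j) (snd j) X) \<le> real (card ?J) * (4 * p * y / real N)"
  proof (rule rprob_Bex_le)
    fix j assume j: "j \<in> ?J"
    show "rprob ?box p (stalled N (fst j) (snd j)) \<le> 4 * p * y / real N"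
      unfolding y_def by (rule rprob_stalled[OF _ _ p y[unfolded y_def]]) (use j in auto)
  qed simp
  also have "\<dots> = 4 * p * y * real (N div 2)" using N by (simp add: field_simps)
  also have "\<dots> \<le> 4 * p * y * (real N / 2)"
  proof (rule mult_left_mono)
    show "real (N div 2) \<le> real N / 2" by linarith
  qed (use p y0 in simp)
  finally show ?thesis by (simp add: mult_ac)
qed

section \<open>Filling a box of side of order \<open>1/p\<close>\<close>

text \<open>Here c stands for Np. The shifts c + 1 and c - 1 absorb the rounding in N and the
  passage from N to N - 1.\<close>

lemma ex_large_constant:
  fixes \<epsilon> :: real
  assumes "\<epsilon> > 0"
  obtains c where "c \<ge> 1" "2 * exp 1 * (c + 1) * exp (- (c - 1) / 4) \<le> 1/2"
    "exp (- c * (c - 1) / 2) + 2 * (c + 1) * (2 * exp 1 * (c + 1) * exp (- (c - 1) / 4)) \<le> \<epsilon>"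
proof -
  have 1: "eventually (\<lambda>c::real. 2 * exp 1 * (c + 1) * exp (- (c - 1) / 4) \<le> 1/2) at_top"
    by real_asymp
  have "((\<lambda>c::real. exp (- c * (c - 1) / 2)
      + 2 * (c + 1) * (2 * exp 1 * (c + 1) * exp (- (c - 1) / 4))) \<longlongrightarrow> 0) at_top"
    by real_asymp
  hence "eventually (\<lambda>c::real. exp (- c * (c - 1) / 2)
      + 2 * (c + 1) * (2 * exp 1 * (c + 1) * exp (- (c - 1) / 4)) < \<epsilon>) at_top"
    using assms by (rule order_tendstoD)
  with 1 eventually_ge_at_top[of 1] have "eventually (\<lambda>c::real. c \<ge> 1 \<and>
      2 * exp 1 * (c + 1) * exp (- (c - 1) / 4) \<le> 1/2 \<and>
      exp (- c * (c - 1) / 2) + 2 * (c + 1) * (2 * exp 1 * (c + 1) * exp (- (c - 1) / 4)) \<le> \<epsilon>) at_top"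
    by eventually_elim auto
  thus ?thesis using that eventually_happens[of _ "at_top :: real filter"] by auto
qed

lemma rprob_not_filled_le:
  fixes p c \<epsilon> :: real
  defines "N \<equiv> nat \<lceil>c / p\<rceil>"
  assumes r: "r \<ge> 2" and p: "0 < p" "p \<le> 1" and G: "N + 1 < 2 ^ G"
    and c: "c \<ge> 1" "2 * exp 1 * (c + 1) * exp (- (c - 1) / 4) \<le> 1/2"
    "exp (- c * (c - 1) / 2) + 2 * (c + 1) * (2 * exp 1 * (c + 1) * exp (- (c - 1) / 4)) \<le> \<epsilon>"
  shows "rprob (lattice_box (2 * N)) p (\<lambda>X. \<not> filled_by r (2 * N) ((G + 2) * (2 * N + 1)) X) \<le> \<epsilon>"
proof -
  define y where "y = 2 * exp 1 * (real N * p) * exp (- p * (real N - 1) / 4)"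
  define Y where "Y = 2 * exp 1 * (c + 1) * exp (- (c - 1) / 4)"
  have N: "c / p \<le> real N" "real N \<le> c / p + 1" using c p by (auto simp: N_def)
  have Np: "c \<le> real N * p" "real N * p \<le> c + 1"
  proof -
    show "c \<le> real N * p" using N(1) p by (simp add: field_simps)
    have "real N * p \<le> (c / p + 1) * p" using N(2) p by (intro mult_right_mono) auto
    also have "\<dots> = c + p" using p by (simp add: field_simps)
    finally show "real N * p \<le> c + 1" using p by simp
  qed
  have N0: "N > 0" using Np(1) c(1) by (cases N) auto
  have pN: "p * (real N - 1) \<ge> c - 1" using Np(1) p by (simp add: algebra_simps)
  have "y \<le> Y"
    unfolding y_def Y_def using Np pN c(1) p by (intro mult_mono) auto
  have y0: "y \<ge> 0" using p by (simp add: y_def)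
  have "(1 - p\<^sup>2) ^ (N * (N div 2)) \<le> exp (- p\<^sup>2) ^ (N * (N div 2))"
    using p exp_ge_add_one_self[of "- p\<^sup>2"] by (intro power_mono) (auto simp: power_le_one)
  also have "\<dots> = exp (- (p * real N) * (p * real (N div 2)))"
    by (simp add: exp_of_nat_mult[symmetric] power2_eq_square mult_ac)
  also have "\<dots> \<le> exp (- c * ((c - 1) / 2))"
  proof -
    have "real N - 1 \<le> 2 * real (N div 2)" by linarith
    hence "p * (real N - 1) \<le> p * (2 * real (N div 2))" using p by (intro mult_left_mono) auto
    hence "(c - 1) / 2 \<le> p * real (N div 2)" using pN by simp
    hence "c * ((c - 1) / 2) \<le> (p * real N) * (p * real (N div 2))"
      using Np c(1) p by (intro mult_mono) (auto simp: mult.commute)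
    thus ?thesis by simp
  qed
  finally have 1: "(1 - p\<^sup>2) ^ (N * (N div 2)) \<le> exp (- c * (c - 1) / 2)" by simp
  have "(2 * (real N * p)) * y \<le> (2 * (c + 1)) * Y"
    using Np y0 \<open>y \<le> Y\<close> c(1) by (intro mult_mono) auto
  hence "2 * real N * p * y \<le> 2 * (c + 1) * Y" by (simp only: mult.assoc)
  moreover have "y \<le> 1/2" using \<open>y \<le> Y\<close> c(2) by (simp add: Y_def)
  ultimately show ?thesis
    using rprob_not_filled[OF r p, of N G] N0 G 1 c(3) unfolding y_def[symmetric] Y_def[symmetric]
    by simp
qed

text \<open>One event serves both upper bounds: the side C/p is used for the critical length, with
  \<epsilon> = 1/2, and the time for the occupation of the origin.\<close>

lemma box_filled_with_high_probability:
  fixes \<epsilon> :: real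
  assumes r: "r \<ge> 2" and \<epsilon>: "\<epsilon> > 0"
  obtains C K where "C > 0" "K > 0"
    "eventually (\<lambda>p. \<exists>n t. n \<ge> 1 \<and> real n \<le> C / p \<and> real t \<le> K * (1 / p * ln (1 / p)) \<and>
       rprob (lattice_box n) p (\<lambda>X. \<not> filled_by r n t X) \<le> \<epsilon>) (at_right 0)"
proof -
  obtain c where c: "c \<ge> 1" "2 * exp 1 * (c + 1) * exp (- (c - 1) / 4) \<le> 1/2"
    "exp (- c * (c - 1) / 2) + 2 * (c + 1) * (2 * exp 1 * (c + 1) * exp (- (c - 1) / 4)) \<le> \<epsilon>"
    using ex_large_constant[OF \<epsilon>] .
  \<comment> \<open>The limit of the ratio below, increased by 1 so that the ratio is eventually
    smaller.\<close>
  define K where "K = (2 * c + 3) / ln 2 + 1"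
  have "((\<lambda>p. (log 2 ((c + 3) / p) + 3) * ((2 * c + 3) / p) / (1 / p * ln (1 / p)))
      \<longlongrightarrow> (2 * c + 3) / ln 2) (at_right 0)"
    using c(1) by (real_asymp simp: field_simps)
  hence ev: "eventually (\<lambda>p. (log 2 ((c + 3) / p) + 3) * ((2 * c + 3) / p) / (1 / p * ln (1 / p)) < K) (at_right 0)"
    by (rule order_tendstoD) (simp add: K_def)
  have ev1: "eventually (\<lambda>p::real. 0 < p \<and> p < 1) (at_right 0)"
    unfolding eventually_at_right_field by (intro exI[of _ 1]) auto
  have "eventually (\<lambda>p. \<exists>n t. n \<ge> 1 \<and> real n \<le> 2 * (c + 1) / p \<and> real t \<le> K * (1 / p * ln (1 / p)) \<and>
       rprob (lattice_box n) p (\<lambda>X. \<not> filled_by r n t X) \<le> \<epsilon>) (at_right 0)"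
    using ev ev1
  proof eventually_elim
    case (elim p)
    define N where "N = nat \<lceil>c / p\<rceil>"
    define G where "G = nat \<lceil>log 2 (real (N + 2))\<rceil>"
    have N: "c / p \<le> real N" "real N \<le> c / p + 1" using c elim by (auto simp: N_def)
    have N': "real N \<le> (c + 1) / p" using N(2) elim by (simp add: field_simps)
    have p1: "1 / p \<ge> 1" using elim by simp
    have "c / p > 0" using c(1) elim by simp
    hence N0: "N > 0" using N(1) by linarith
    have "real (N + 2) = 2 powr log 2 (real (N + 2))" by simp
    also have "\<dots> \<le> 2 powr real G" unfolding G_def by (intro powr_mono) linarith+
    also have "\<dots> = real (2 ^ G)" by (simp add: powr_realpow)
    finally have G: "N + 1 < 2 ^ G" by (simp only: of_nat_le_iff)
    have "real N + 2 \<le> (c + 3) / p" using N' p1 by (simp add: add_divide_distrib)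
    hence "log 2 (real (N + 2)) \<le> log 2 ((c + 3) / p)" by (subst log_le_cancel_iff) (auto intro: less_le_trans)
    moreover have "real G \<le> log 2 (real (N + 2)) + 1"
      unfolding G_def using zero_le_log_cancel_iff[of 2 "real (N + 2)"] by (subst of_nat_nat) linarith+
    ultimately have "real (G + 2) \<le> log 2 ((c + 3) / p) + 3" by simp
    moreover have "real (2 * N + 1) \<le> (2 * c + 3) / p"
      using N' p1 by (simp add: add_divide_distrib)
    ultimately have "real (G + 2) * real (2 * N + 1) \<le> (log 2 ((c + 3) / p) + 3) * ((2 * c + 3) / p)"
      by (intro mult_mono) auto
    also have "\<dots> \<le> K * (1 / p * ln (1 / p))"
      using elim by (simp add: pos_divide_less_eq less_imp_le)
    finally have "real ((G + 2) * (2 * N + 1)) \<le> K * (1 / p * ln (1 / p))" unfolding of_nat_mult .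
    moreover have "rprob (lattice_box (2 * N)) p
        (\<lambda>X. \<not> filled_by r (2 * N) ((G + 2) * (2 * N + 1)) X) \<le> \<epsilon>"
      unfolding N_def using elim G[unfolded N_def] by (intro rprob_not_filled_le[OF r _ _ _ c]) auto
    moreover have "2 * N \<ge> 1" "real (2 * N) \<le> 2 * (c + 1) / p"
      using N0 mult_left_mono[OF N', of 2] by simp_all
    ultimately show ?case by blast
  qed
  moreover have "2 * (c + 1) > 0" "K > 0" using c(1) by (auto simp: K_def add_pos_pos)
  ultimately show ?thesis using that by blast
qed

section \<open>The critical length and the upper bound on the occupation time\<close>

lemma eventually_small_p: "c > 0 \<Longrightarrow> eventually (\<lambda>p::real. 0 < p \<and> p < c) (at_right 0)"
  unfolding eventually_at_right_field by (intro exI[of _ c]) auto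

lemma Limsup_tendsto_0:
  fixes f :: "real \<Rightarrow> real \<Rightarrow> real"
  assumes "\<And>l p. f l p \<ge> 0"
    and "\<And>\<epsilon>. \<epsilon> > 0 \<Longrightarrow> eventually (\<lambda>l. eventually (\<lambda>p. f l p \<le> \<epsilon>) (at_right 0)) F"
  shows "((\<lambda>l. Limsup (at_right 0) (\<lambda>p. ereal (f l p))) \<longlongrightarrow> 0) F"
proof (rule order_tendstoI)
  fix a :: ereal assume "a < 0"
  moreover have "0 \<le> Limsup (at_right 0) (\<lambda>p. ereal (f l p))" for l
    using assms(1) by (intro le_Limsup) auto
  ultimately show "eventually (\<lambda>l. a < Limsup (at_right 0) (\<lambda>p. ereal (f l p))) F"
    by (intro always_eventually) (auto intro: less_le_trans)
next
  fix a :: ereal assume "0 < a"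
  then obtain \<epsilon> where \<epsilon>: "0 < ereal \<epsilon>" "ereal \<epsilon> < a" using ereal_dense2 by blast
  have "eventually (\<lambda>l. eventually (\<lambda>p. f l p \<le> \<epsilon>) (at_right 0)) F"
    using \<epsilon>(1) by (intro assms(2)) auto
  thus "eventually (\<lambda>l. Limsup (at_right 0) (\<lambda>p. ereal (f l p)) < a) F"
  proof eventually_elim
    case (elim l)
    hence "Limsup (at_right 0) (\<lambda>p. ereal (f l p)) \<le> ereal \<epsilon>"
      by (intro Limsup_bounded) (auto elim: eventually_mono)
    thus ?case using \<epsilon>(2) by (rule le_less_trans)
  qed
qed

lemma occupation_time_le:
  assumes "filled_by r n t (X \<inter> lattice_box n)" "n \<ge> 1"
  shows "occupation_time r Z2 X \<le> enat t"
proof -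
  have "(0, 0) \<in> lattice_box n" using assms(2) by (simp add: lattice_box_def)
  hence "(0, 0) \<in> growth (lattice_box n) r Z2 (X \<inter> lattice_box n) t"
    using assms(1) by (auto simp: filled_by_def Int_assoc)
  also have "\<dots> \<subseteq> growth UNIV r Z2 X t" by (rule growth_mono) auto
  finally show ?thesis unfolding occupation_time_def by (intro INF_lower) simp
qed

lemma occupation_time_lesssim:
  assumes r: "r \<ge> 2"
  shows "prob_lesssim site_measure
    (\<lambda>p \<omega>. ereal_of_enat (occupation_time r Z2 (Collect \<omega>))) (\<lambda>p. 1 / p * ln (1 / p))"
  unfolding prob_lesssim_def
proof (rule Limsup_tendsto_0)
  fix \<epsilon> :: real assume "\<epsilon> > 0"
  then obtain C K where CK: "C > 0" "K > 0"
    "eventually (\<lambda>p. \<exists>n t. n \<ge> 1 \<and> real n \<le> C / p \<and> real t \<le> K * (1 / p * ln (1 / p)) \<and>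
       rprob (lattice_box n) p (\<lambda>X. \<not> filled_by r n t X) \<le> \<epsilon>) (at_right 0)"
    by (rule box_filled_with_high_probability[OF r])
  have "eventually (\<lambda>p. \<P>(\<omega> in site_measure p. ereal (l * (1 / p * ln (1 / p)))
      \<le> ereal_of_enat (occupation_time r Z2 (Collect \<omega>))) \<le> \<epsilon>) (at_right 0)" if l: "l > K" for l
    using CK(3) eventually_small_p[of 1, simplified]
  proof eventually_elim
    case (elim p)
    then obtain n t where nt: "n \<ge> 1" "real t \<le> K * (1 / p * ln (1 / p))"
      "rprob (lattice_box n) p (\<lambda>X. \<not> filled_by r n t X) \<le> \<epsilon>" by blast
    have "1 / p * ln (1 / p) > 0" using elim by (intro mult_pos_pos) auto
    hence less: "real t < l * (1 / p * ln (1 / p))"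
      using nt(2) l by (intro le_less_trans[OF nt(2)] mult_strict_right_mono)
    have "measure (site_measure p) {\<omega>. ereal (l * (1 / p * ln (1 / p)))
        \<le> ereal_of_enat (occupation_time r Z2 (Collect \<omega>))}
      \<le> rprob (lattice_box n) p (\<lambda>X. \<not> filled_by r n t X)"
    proof (rule site_measure_le_rprob[OF finite_lattice_box])
      fix \<omega> assume \<omega>: "ereal (l * (1 / p * ln (1 / p))) \<le> ereal_of_enat (occupation_time r Z2 (Collect \<omega>))"
      show "\<not> filled_by r n t (Collect \<omega> \<inter> lattice_box n)"
      proof
        assume "filled_by r n t (Collect \<omega> \<inter> lattice_box n)"
        from occupation_time_le[OF this nt(1)]
        have "ereal_of_enat (occupation_time r Z2 (Collect \<omega>)) \<le> ereal_of_enat (enat t)"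
          by (simp only: ereal_of_enat_le_iff)
        with \<omega> have "ereal (l * (1 / p * ln (1 / p))) \<le> ereal_of_enat (enat t)"
          by (rule order_trans)
        thus False using less by simp
      qed
    qed (use elim in auto)
    thus ?case using nt(3) by simp
  qed
  thus "eventually (\<lambda>l. eventually (\<lambda>p. \<P>(\<omega> in site_measure p. ereal (l * (1 / p * ln (1 / p)))
      \<le> ereal_of_enat (occupation_time r Z2 (Collect \<omega>))) \<le> \<epsilon>) (at_right 0)) at_top"
    using eventually_gt_at_top[of K] by (rule eventually_mono[rotated])
qed simp

lemma prob_spans_box:
  assumes "0 \<le> p" "p \<le> 1"
  shows "\<P>(\<omega> in site_measure p. spans_box r Z2 n (Collect \<omega>)) = rprob (lattice_box n) p (spans_box r Z2 n)"
  using site_measure_finite_event(2)[OF finite_lattice_box assms, of "spans_box r Z2 n" n]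
  by (simp add: spans_box_def Int_assoc)

section \<open>Boxes of side c/p without close pairs\<close>

definition close_pair :: "int \<Rightarrow> (int \<times> int) set \<Rightarrow> bool" where
  "close_pair r X \<longleftrightarrow> (\<exists>d. \<exists>v\<in>X. \<exists>k\<in>{- 2 * r..2 * r} - {0}. site d (crd d v) (crd (\<not> d) v + k) \<in> X)"

text \<open>Two occupied sites that one site sees along a line are at most 2r apart, so the first
  change of the set would reveal a close pair.\<close>

lemma growth_without_close_pair:
  assumes "\<not> close_pair r X"
  shows "growth \<Lambda> r Z2 X t = X"
proof (induction t)
  case (Suc t)
  show ?case
  proof (rule ccontr)
    assume "growth \<Lambda> r Z2 X (Suc t) \<noteq> X"
    moreover have "X \<subseteq> growth \<Lambda> r Z2 X (Suc t)"
      using growth_le[of 0 "Suc t" \<Lambda> r Z2 X] by simp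
    ultimately obtain z where z: "z \<in> growth \<Lambda> r Z2 X (Suc t)" "z \<notin> X" by auto
    from z(1) show False
    proof (cases rule: growth_SucE)
      case old
      thus ?thesis using z(2) Suc.IH by simp
    next
      case (new d v w)
      let ?k = "crd (\<not> d) w - crd (\<not> d) v"
      have "crd d w = crd d v" "\<bar>?k\<bar> \<le> 2 * r" using new(4,5) by (auto simp: segment_def)
      moreover from this(1) have "?k \<noteq> 0" using new(6) site_eqI[of d w v] by auto
      moreover have "site d (crd d v) (crd (\<not> d) v + ?k) = w"
        unfolding \<open>crd d w = crd d v\<close>[symmetric] by simp
      ultimately have "close_pair r X"
        unfolding close_pair_def using new(2,3) unfolding Suc.IH
        by (intro exI[of _ d] bexI[of _ v] bexI[of _ ?k]) auto
      thus ?thesis using assms by simp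
    qed
  qed
qed simp

text \<open>If the box is spanned, its corner at the origin is occupied initially or there is a
  close pair. The latter has 2 n^2 4r choices of direction, site and offset, each of probability at
  most p^2.\<close>

lemma rprob_spans_box:
  assumes n: "n \<ge> 1" and r: "r \<ge> 0" and p: "0 \<le> p" "p \<le> 1"
  shows "rprob (lattice_box n) p (spans_box r Z2 n) \<le> p + 8 * real_of_int r * (real n * p)\<^sup>2"
proof -
  let ?box = "lattice_box n" and ?D = "{- 2 * r..2 * r} - {0::int}"
  let ?I = "(UNIV :: bool set) \<times> ?box \<times> ?D"
  let ?A = "\<lambda>(d, v, k). {v, site d (crd d v) (crd (\<not> d) v + k)}"
  have card_I: "card ?I = 2 * (n * n) * nat (4 * r)"
  proof -
    have "card ?D = nat (4 * r)" using r by (subst card_Diff_singleton) auto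
    thus ?thesis by (simp add: card_cartesian_product card_lattice_box)
  qed
  have "rprob ?box p (spans_box r Z2 n) \<le> rprob ?box p (\<lambda>X. {(0, 0)} \<subseteq> X \<or> (\<exists>i\<in>?I. ?A i \<subseteq> X))"
  proof (rule rprob_mono[OF finite_lattice_box])
    fix X assume X: "X \<subseteq> ?box" and spans: "spans_box r Z2 n X"
    show "{(0, 0)} \<subseteq> X \<or> (\<exists>i\<in>?I. ?A i \<subseteq> X)"
    proof (cases "close_pair r X")
      case True
      then obtain d v k where "v \<in> X" "k \<in> ?D" "site d (crd d v) (crd (\<not> d) v + k) \<in> X"
        unfolding close_pair_def by blast
      thus ?thesis using X by (intro disjI2 bexI[of _ "(d, v, k)"]) auto
    next
      case False
      have "(0, 0) \<in> ?box" using n by (simp add: lattice_box_def)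
      hence "(0, 0) \<in> X"
        using spans X growth_without_close_pair[OF False]
        by (auto simp: spans_box_def Int_absorb2)
      thus ?thesis by simp
    qed
  qed
  also have "\<dots> \<le> rprob ?box p (\<lambda>X. {(0, 0)} \<subseteq> X) + rprob ?box p (\<lambda>X. \<exists>i\<in>?I. ?A i \<subseteq> X)"
    by (rule rprob_disj)
  also have "rprob ?box p (\<lambda>X. {(0, 0)} \<subseteq> X) \<le> p ^ card {(0::int, 0::int)}"
    using p by (intro rprob_subset finite_lattice_box) auto
  also have "rprob ?box p (\<lambda>X. \<exists>i\<in>?I. ?A i \<subseteq> X) \<le> real (card ?I) * p ^ 2"
  proof (rule rprob_Bex_le)
    fix i assume "i \<in> ?I"
    then obtain d v k where i: "i = (d, v, k)" "k \<noteq> 0" by auto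
    have "v \<noteq> site d (crd d v) (crd (\<not> d) v + k)"
    proof
      assume "v = site d (crd d v) (crd (\<not> d) v + k)"
      hence "crd (\<not> d) v = crd (\<not> d) (site d (crd d v) (crd (\<not> d) v + k))" by simp
      thus False using i(2) by simp
    qed
    hence "card (?A i) = 2" unfolding i prod.case by (subst card_2_iff) blast
    thus "rprob ?box p (\<lambda>X. ?A i \<subseteq> X) \<le> p ^ 2"
      using rprob_subset[OF finite_lattice_box[of n] p, of "?A i"] i by simp
  qed (simp add: finite_lattice_box)
  finally show ?thesis
    unfolding card_I using r by (simp add: power2_eq_square mult_ac)
qed

lemma critical_length_bounds:
  assumes r: "r \<ge> 2"
  obtains c C where "c > 0" "C > 0"
    "eventually (\<lambda>p. \<exists>n. critical_length r Z2 p = enat n \<and> c / p \<le> real n \<and> real n \<le> C / p) (at_right 0)"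
proof -
  obtain C K where CK: "C > 0" "K > 0"
    "eventually (\<lambda>p. \<exists>n t. n \<ge> 1 \<and> real n \<le> C / p \<and> real t \<le> K * (1 / p * ln (1 / p)) \<and>
       rprob (lattice_box n) p (\<lambda>X. \<not> filled_by r n t X) \<le> 1/2) (at_right 0)"
    by (rule box_filled_with_high_probability[OF r, of "1/2"]) auto
  \<comment> \<open>Chosen so that 8 r c^2 = c; below c/p the spanning probability is then at most p
    + c, less than 1/4 + 1/16.\<close>
  define c where "c = 1 / (8 * real_of_int r)"
  have c: "c > 0" using r by (simp add: c_def)
  have "eventually (\<lambda>p. \<exists>n. critical_length r Z2 p = enat n \<and> c / p \<le> real n \<and> real n \<le> C / p) (at_right 0)"
    using CK(3) eventually_small_p[of "1/4", simplified]
  proof eventually_elim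
    case (elim p)
    then obtain n t where nt: "n \<ge> 1" "real n \<le> C / p"
      "rprob (lattice_box n) p (\<lambda>X. \<not> filled_by r n t X) \<le> 1/2" by blast
    have p: "0 \<le> p" "p \<le> 1" using elim by auto
    let ?S = "{n. 1 \<le> n \<and> \<P>(\<omega> in site_measure p. spans_box r Z2 n (Collect \<omega>)) \<ge> 1 / 2}"
    have "1 - rprob (lattice_box n) p (\<lambda>X. \<not> filled_by r n t X) = rprob (lattice_box n) p (filled_by r n t)"
      using measure_pmf.prob_compl[of "{X. filled_by r n t X}" "random_subset (lattice_box n) p"]
      by (simp add: Compl_eq_Diff_UNIV[symmetric] Collect_neg_eq)
    also have "\<dots> \<le> rprob (lattice_box n) p (spans_box r Z2 n)"
      by (rule rprob_mono[OF finite_lattice_box]) (auto simp: filled_by_def spans_box_def)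
    finally have "n \<in> ?S" using nt unfolding prob_spans_box[OF p] by simp
    then obtain m where m: "m \<in> ?S" "(INF n\<in>?S. enat n) = enat m" "\<And>k. k \<in> ?S \<Longrightarrow> m \<le> k"
      using enat_INF_attained[of ?S] by blast
    have "real m \<le> C / p" using m(3)[OF \<open>n \<in> ?S\<close>] nt(2) by linarith
    moreover have "c / p \<le> real m"
    proof (rule ccontr)
      assume "\<not> c / p \<le> real m"
      hence "real m * p < c" using elim by (simp add: field_simps)
      hence "(real m * p)\<^sup>2 \<le> c\<^sup>2" using p by (intro power_mono) auto
      hence "8 * real_of_int r * (real m * p)\<^sup>2 \<le> 8 * real_of_int r * c\<^sup>2"
        using r by (intro mult_left_mono) auto
      also have "\<dots> = c" using r by (simp add: c_def power2_eq_square)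
      also have "c \<le> 1/16" using r by (simp add: c_def field_simps)
      finally have "rprob (lattice_box m) p (spans_box r Z2 m) < 1/2"
        using rprob_spans_box[of m r p] m(1) r p elim by simp
      thus False using m(1) unfolding prob_spans_box[OF p] by simp
    qed
    ultimately show ?case using m(2) unfolding critical_length_def by blast
  qed
  thus ?thesis using that c CK(1) by blast
qed

section \<open>Chains of activations\<close>

definition square :: "int \<Rightarrow> (int \<times> int) set" where
  "square D = {- D..D} \<times> {- D..D}"

lemma finite_square: "finite (square D)"
  by (simp add: square_def)

lemma square_iff: "z \<in> square D \<longleftrightarrow> (\<forall>d. \<bar>crd d z\<bar> \<le> D)"
  by (cases z) (auto simp: square_def crd_def all_bool_eq abs_le_iff)

lemma squareD: "z \<in> square D \<Longrightarrow> \<bar>crd d z\<bar> \<le> D"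
  by (auto simp: square_iff)

lemma site_in_square: "site d c x \<in> square D \<longleftrightarrow> \<bar>c\<bar> \<le> D \<and> \<bar>x\<bar> \<le> D"
  by (auto simp: square_def site_def)

text \<open>\<open>chain r D d z b S\<close>: the initial sites in \<open>S\<close> suffice to activate the \<open>d\<close>-line through \<open>z\<close>, either
  because it contains two close sites of \<open>S\<close>, or because a site \<open>u\<close> of \<open>S\<close> on it is close to
  the perpendicular line through \<open>v\<close>, which is activated by \<open>S - {u}\<close>. The budget \<open>b\<close> bounds the distance
  covered, hence the time needed; every step costs at least \<open>2 r\<close>, which keeps the budget
  when a chain is restarted at one of its sites (\<open>chain_source\<close>). That no site is used twice
  makes the occupation of \<open>u\<close> independent of the rest of the chain.\<close>

inductive chain ::
    "int \<Rightarrow> int \<Rightarrow> bool \<Rightarrow> int \<times> int \<Rightarrow> nat \<Rightarrow> (int \<times> int) set \<Rightarrow> bool" for r D where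
  seed: "\<lbrakk>z \<in> square D; u \<in> square D; w \<in> square D; u \<noteq> w; crd d u = crd d z; crd d w = crd d z;
     \<bar>crd (\<not> d) u - crd (\<not> d) w\<bar> \<le> 2 * r; \<bar>crd (\<not> d) z - crd (\<not> d) u\<bar> \<le> int b\<rbrakk>
     \<Longrightarrow> chain r D d z b {u, w}"
| step: "\<lbrakk>z \<in> square D; u \<in> square D; v \<in> square D; u \<noteq> v; crd d u = crd d z; crd d v = crd d z;
     \<bar>crd (\<not> d) u - crd (\<not> d) v\<bar> \<le> 2 * r; \<bar>crd (\<not> d) z - crd (\<not> d) v\<bar> + int b' \<le> int b;
     int b' + 2 * r \<le> int b; u \<notin> S; chain r D (\<not> d) v b' S\<rbrakk>
     \<Longrightarrow> chain r D d z b (insert u S)"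

lemma chain_in_square: "chain r D d z b S \<Longrightarrow> z \<in> square D"
  by (auto elim: chain.cases)

lemma chain_finite: "chain r D d z b S \<Longrightarrow> finite S"
  by (induction rule: chain.induct) auto

lemma chain_shift:
  assumes "chain r D d z b S" "z' \<in> square D" "crd d z' = crd d z"
    "\<bar>crd (\<not> d) z' - crd (\<not> d) z\<bar> + int b \<le> int b'"
  shows "chain r D d z' b' S"
  using assms(1)
proof (cases rule: chain.cases)
  case (seed u w)
  show ?thesis
    unfolding seed(1) using seed(2-) assms(2-) by (intro chain.seed) auto
next
  case (step u v b0 S0)
  show ?thesis
    unfolding step(1) by (rule chain.step[OF assms(2) step(3,4,5) _ _ step(8)]) (use step assms(2-) in auto)
qed

text \<open>Both sites of a seed lie on the activated line, and so does the site \<open>u\<close> of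
  a step, at most 2r from the crossing point \<open>v\<close>, which the reserve of 2r covers. All
  other sites belong to the shorter chain.\<close>

lemma chain_source:
  assumes "chain r D d z b S" "x \<in> S"
  shows "\<exists>d' b' S'. chain r D d' x b' S' \<and> S' \<subseteq> S \<and> b' \<le> b"
  using assms
proof (induction rule: chain.induct)
  case (seed z u w d b)
  have "chain r D d u b {u, w}" using seed by (intro chain.seed) auto
  moreover have "chain r D d w b {w, u}" using seed by (intro chain.seed) auto
  ultimately show ?case using seed.prems by (auto simp: insert_commute)
next
  case (step z u v d b' b S)
  show ?case
  proof (cases "x = u")
    case True
    have "chain r D d u b (insert u S)"
      by (rule chain.step[OF step.hyps(2,2,3,4) _ _ step.hyps(7) _ step.hyps(9,10,11)]) (use step.hyps in auto)
    thus ?thesis using True by blast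
  next
    case False
    hence "\<exists>d' b'' S'. chain r D d' x b'' S' \<and> S' \<subseteq> S \<and> b'' \<le> b'" using step by auto
    then obtain d' b'' S' where *: "chain r D d' x b'' S'" "S' \<subseteq> S" "b'' \<le> b'" by blast
    moreover have "b' \<le> b" using step.hyps(8) by linarith
    ultimately have "b'' \<le> b" "S' \<subseteq> insert u S" by auto
    with *(1) show ?thesis by blast
  qed
qed

section \<open>Active lines and danger events\<close>

definition active ::
    "int \<Rightarrow> int \<Rightarrow> (int \<times> int) set \<Rightarrow> bool \<Rightarrow> int \<times> int \<Rightarrow> nat \<Rightarrow> bool" where
  "active r D X d z b \<longleftrightarrow> (\<exists>S\<subseteq>X. chain r D d z b S)"

text \<open>The reference point at position 0 makes this a property of the line alone; moving the
  reference point there costs at most D of the budget.\<close>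

definition active_line ::
    "int \<Rightarrow> int \<Rightarrow> nat \<Rightarrow> (int \<times> int) set \<Rightarrow> bool \<Rightarrow> int \<Rightarrow> bool" where
  "active_line r D b X d c \<longleftrightarrow> active r D X d (site d c 0) b"

lemma active_mono: "active r D X d z b \<Longrightarrow> X \<subseteq> Y \<Longrightarrow> active r D Y d z b"
  unfolding active_def by blast

lemma active_line_mono: "active_line r D b X d c \<Longrightarrow> X \<subseteq> Y \<Longrightarrow> active_line r D b Y d c"
  unfolding active_line_def by (rule active_mono)

lemma active_shift:
  assumes "active r D X d z b" "z' \<in> square D" "crd d z' = crd d z"
    "\<bar>crd (\<not> d) z' - crd (\<not> d) z\<bar> + int b \<le> int b'"
  shows "active r D X d z' b'"
  using assms chain_shift[of r D d z b _ z' b'] unfolding active_def by blast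

lemma active_imp_line:
  assumes "active r D X d z b" "D + int b \<le> int B"
  shows "active_line r D B X d (crd d z)"
proof -
  have z: "z \<in> square D" using assms(1) chain_in_square unfolding active_def by blast
  have "\<bar>crd d z\<bar> \<le> D" "\<bar>crd (\<not> d) z\<bar> \<le> D" using z by (auto intro: squareD)
  thus ?thesis
    unfolding active_line_def using assms(2)
    by (intro active_shift[OF assms(1)]) (auto simp: site_in_square)
qed

lemma active_line_bound: "active_line r D b X d c \<Longrightarrow> \<bar>c\<bar> \<le> D"
  unfolding active_line_def active_def using chain_in_square site_in_square by blast

definition dangerous :: "int \<Rightarrow> int \<Rightarrow> nat \<Rightarrow> (int \<times> int) set \<Rightarrow> int \<times> int \<Rightarrow> bool" where
  "dangerous r D B X u \<longleftrightarrow> (\<exists>c c'. active_line r D B X True c \<and> active_line r D B X False c' \<and>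
     \<bar>crd True u - c\<bar> \<le> 2 * r \<and> \<bar>crd False u - c'\<bar> \<le> 2 * r)"

definition crossing_danger :: "int \<Rightarrow> int \<Rightarrow> nat \<Rightarrow> (int \<times> int) set \<Rightarrow> bool" where
  "crossing_danger r D B X \<longleftrightarrow> (\<exists>u\<in>X. dangerous r D B (X - {u}) u)"

text \<open>This covers two close lines that both start from a pair: no perpendicular line comes
  near their sites, but the pair of one and the chain of the other use different sites.\<close>

definition seed_danger :: "int \<Rightarrow> int \<Rightarrow> nat \<Rightarrow> (int \<times> int) set \<Rightarrow> bool" where
  "seed_danger r D B X \<longleftrightarrow> (\<exists>d. \<exists>u\<in>X. \<exists>w\<in>X - {u}. \<exists>c. crd d u = crd d w \<and>
     \<bar>crd (\<not> d) u - crd (\<not> d) w\<bar> \<le> 2 * r \<and> \<bar>crd d u - c\<bar> \<le> 2 * r \<and>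
     active_line r D B (X - {u} - {w}) d c)"

lemma crossing_dangerI:
  assumes "u \<in> X" "active_line r D B (X - {u}) d c" "\<bar>crd d u - c\<bar> \<le> 2 * r"
    "active_line r D B (X - {u}) (\<not> d) c'" "\<bar>crd (\<not> d) u - c'\<bar> \<le> 2 * r"
  shows "crossing_danger r D B X"
  unfolding crossing_danger_def dangerous_def using assms by (cases d) auto

text \<open>If two close parallel lines have chains, choose them with as few sites as possible. If the first
  site \<open>u\<close> of one chain does not occur in the other one, then \<open>u\<close> lies close to a row and to a column
  that are activated without it. Otherwise the other chain can be restarted at \<open>u\<close>, which
  yields such a site or a smaller pair of close parallel lines.\<close>

lemma close_lines_danger:
  assumes "chain r D d v b S" "chain r D d v' b' S'" "S \<subseteq> X" "S' \<subseteq> X"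
    "D + int b \<le> int B" "D + int b' \<le> int B"
    "crd d v \<noteq> crd d v'" "\<bar>crd d v - crd d v'\<bar> \<le> 2 * r"
  shows "crossing_danger r D B X \<or> seed_danger r D B X"
  using assms
proof (induction "card S + card S'" arbitrary: d v b S v' b' S' rule: less_induct)
  case less
  note ch = less.prems(1,2) and sub = less.prems(3,4) and B = less.prems(5,6)
    and neq = less.prems(7) and close = less.prems(8)
  have line: "active_line r D B Y d' (crd d' z)"
    if "chain r D d' z b0 S0" "S0 \<subseteq> Y" "D + int b0 \<le> int B" for Y d' z b0 S0
    using that by (intro active_imp_line) (auto simp: active_def)
  have first_step: "crossing_danger r D B X"
    if "S = insert u S1" "u \<notin> S1" "crd d u = crd d v" "\<bar>crd (\<not> d) u - crd (\<not> d) w\<bar> \<le> 2 * r"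
      "chain r D (\<not> d) w b1 S1" "D + int b1 \<le> int B" "S \<subseteq> X"
      "chain r D d v' b' S'" "D + int b' \<le> int B" "S' \<subseteq> X" "u \<notin> S'" "\<bar>crd d v - crd d v'\<bar> \<le> 2 * r"
    for u S1 w b1 S v v' S' b'
  proof -
    have "u \<in> X" "S' \<subseteq> X - {u}" "S1 \<subseteq> X - {u}" using that(1,2,7,10,11) by auto
    moreover from this have "active_line r D B (X - {u}) d (crd d v')"
      "active_line r D B (X - {u}) (\<not> d) (crd (\<not> d) w)"
      using line[OF that(8) _ that(9)] line[OF that(5) _ that(6)] by blast+
    ultimately show ?thesis using that(3,4,12) by (intro crossing_dangerI) auto
  qed
  from ch(1) show ?case
  proof (cases rule: chain.cases)
    case L: (seed u1 u2)
    from ch(2) show ?thesis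
    proof (cases rule: chain.cases)
      case L': (seed w1 w2)
      have "S' \<subseteq> X - {u1} - {u2}" using L L' sub neq by auto
      hence "active_line r D B (X - {u1} - {u2}) d (crd d v')" using line[OF ch(2)] B by auto
      moreover have "u1 \<in> X" "u2 \<in> X - {u1}" "crd d u1 = crd d u2" "\<bar>crd d u1 - crd d v'\<bar> \<le> 2 * r"
        using L sub close by auto
      ultimately have "seed_danger r D B X" unfolding seed_danger_def using L(8) by blast
      thus ?thesis ..
    next
      case L': (step u w b1 S1)
      \<comment> \<open>\<open>S\<close> is a pair on the line of \<open>v\<close>, while
        \<open>u\<close> lies on the different line of \<open>v'\<close>.\<close>
      have "u \<notin> S" using L L' neq by auto
      moreover have "D + int b1 \<le> int B" using L'(9) B by linarith
      ultimately have "crossing_danger r D B X"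
        using L' sub B close ch(1) by (intro first_step[of S' u S1 v' w b1 v b S]) (auto simp: abs_minus_commute)
      thus ?thesis ..
    qed
  next
    case L: (step u w b1 S1)
    have b1: "D + int b1 \<le> int B" using L(9) B by linarith
    show ?thesis
    proof (cases "u \<in> S'")
      case False
      hence "crossing_danger r D B X"
        using L sub B close ch(2) b1 by (intro first_step[of S u S1 v w b1 v' b' S']) auto
      thus ?thesis ..
    next
      case u: True
      from ch(2) show ?thesis
      proof (cases rule: chain.cases)
        case L': (seed w1 w2)
        thus ?thesis using u L neq by auto
      next
        case L': (step u' w' b1' S1')
        have b1': "D + int b1' \<le> int B" using L'(9) B by linarith
        have "u \<in> S1'" using u L L' neq by auto
        then obtain d2 b2 S2 where 2: "chain r D d2 u b2 S2" "S2 \<subseteq> S1'" "b2 \<le> b1'"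
          using chain_source[OF L'(12)] by blast
        show ?thesis
        proof (cases "d2 = d")
          case True
          \<comment> \<open>Here \<open>u'\<close> is dangerous: \<open>S1'\<close> activates the
            crossing line through \<open>w'\<close>, its subset \<open>S2\<close> the parallel line
            through \<open>u\<close>, and neither contains \<open>u'\<close>.\<close>
          have "crossing_danger r D B X"
            using L L' sub B close b1' 2 True
            by (intro first_step[of S' u' S1' v' w' b1' u b2 S2]) (auto simp: abs_minus_commute)
          thus ?thesis ..
        next
          case False
          \<comment> \<open>\<open>S1\<close> and \<open>S2\<close> activate the perpendicular lines
            through \<open>w\<close> and \<open>u\<close>, which are distinct and close because
            \<open>u\<close> and \<open>w\<close> are distinct, close and on one line. The induction
            applies since \<open>S1\<close> has lost \<open>u\<close>.\<close>
          hence "d2 = (\<not> d)" by auto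
          hence 3: "chain r D (\<not> d) u b2 S2" using 2(1) by simp
          have fin: "finite S" "finite S'" using ch chain_finite by blast+
          have "card S1 < card S" using L fin by (auto intro!: psubset_card_mono)
          moreover have "card S2 \<le> card S'" using 2(2) L'(1) fin(2) by (intro card_mono) auto
          ultimately have "card S1 + card S2 < card S + card S'" by linarith
          moreover have "crd (\<not> d) w \<noteq> crd (\<not> d) u" using L site_eqI[of d u w] by auto
          ultimately show ?thesis
            using L L' sub 2 3 b1 b1'
            by (intro less.hyps[OF _ L(12) 3]) (auto simp: abs_minus_commute)
        qed
      qed
    qed
  qed
qed

text \<open>Finite speed: a site sees only distance r, so the squares shrink by r per unit of time
  and the infinite initial set enters only through \<open>X\<close>. The budget grows by 2r per unit
  of time: moving the reference point takes at most r, and a new branching takes the 2r that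
  \<open>chain.step\<close> demands.\<close>

lemma growth_covered:
  assumes r: "r \<ge> 0" and X: "X = \<xi>\<^sub>0 \<inter> square (r * int t)"
    and B: "3 * r * int t \<le> int B"
    and safe: "\<not> crossing_danger r (r * int t) B X" "\<not> seed_danger r (r * int t) B X"
    and s: "s \<le> t" and z: "z \<in> growth UNIV r Z2 \<xi>\<^sub>0 s" "z \<in> square (r * (int t - int s))"
  shows "z \<in> \<xi>\<^sub>0 \<or> (\<exists>d. active r (r * int t) X d z (nat (2 * r * int s)))"
  using s z
proof (induction s arbitrary: z)
  case (Suc s)
  let ?D = "r * int t"
  let ?b = "nat (2 * r * int s)" and ?b' = "nat (2 * r * int (Suc s))"
  have b: "int ?b = 2 * r * int s" "int ?b' = 2 * r * int s + 2 * r"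
    using r by (simp_all add: algebra_simps)
  have sq_mono: "square (r * (int t - int k)) \<subseteq> square ?D" for k
  proof -
    have "r * (int t - int k) \<le> ?D" using r by (simp add: algebra_simps)
    thus ?thesis by (auto simp: square_def)
  qed
  have "z \<in> square ?D" using Suc.prems(3) sq_mono by blast
  have "r * int s \<le> ?D" using r Suc.prems(1) by (intro mult_left_mono) auto
  hence budget: "?D + int c \<le> int B" if "c \<le> ?b" for c
    using that B r unfolding b by (simp add: le_nat_iff algebra_simps)
  from Suc.prems(2) show ?case
  proof (cases rule: growth_SucE)
    case old
    have "square (r * (int t - int (Suc s))) \<subseteq> square (r * (int t - int s))"
    proof -
      have "r * (int t - int (Suc s)) \<le> r * (int t - int s)" using r by (intro mult_left_mono) auto
      thus ?thesis by (auto simp: square_def)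
    qed
    hence "z \<in> \<xi>\<^sub>0 \<or> (\<exists>d. active r ?D X d z ?b)"
      using Suc.IH[OF _ old] Suc.prems by auto
    moreover have "active r ?D X d z ?b'" if "active r ?D X d z ?b" for d
      using r by (intro active_shift[OF that \<open>z \<in> square ?D\<close>]) (auto simp: algebra_simps)
    ultimately show ?thesis by blast
  next
    case (new d v w)
    have v': "v \<in> square (r * (int t - int s))"
      and v: "crd d v = crd d z" "\<bar>crd (\<not> d) v - crd (\<not> d) z\<bar> \<le> r"
      if "v \<in> segment r d z" for v
    proof -
      show v: "crd d v = crd d z" "\<bar>crd (\<not> d) v - crd (\<not> d) z\<bar> \<le> r"
        using that by (auto simp: segment_def)
      have z': "\<bar>crd e z\<bar> \<le> r * (int t - int s) - r" for e
        using squareD[OF Suc.prems(3), of e] by (simp add: algebra_simps)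
      have "\<bar>crd e v\<bar> \<le> r * (int t - int s)" for e
      proof (cases "e = d")
        case True
        thus ?thesis using v(1) z'[of e] r by simp
      next
        case False
        hence "e = (\<not> d)" by auto
        moreover have "\<bar>a\<bar> \<le> M" if "\<bar>a - b\<bar> \<le> r" "\<bar>b\<bar> \<le> M - r" for a b M using that by linarith
        ultimately show ?thesis using v(2) z'[of "\<not> d"] by simp
      qed
      thus "v \<in> square (r * (int t - int s))" by (auto simp: square_iff)
    qed
    have IH: "v \<in> \<xi>\<^sub>0 \<or> (\<exists>d. active r ?D X d v ?b)"
      if "v \<in> growth UNIV r Z2 \<xi>\<^sub>0 s" "v \<in> segment r d z" for v
      using Suc.IH[OF _ that(1) v'[OF that(2)]] Suc.prems(1) by auto
    have same: ?thesis if "active r ?D X d v c" "c \<le> ?b" "v \<in> segment r d z" for v c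
    proof -
      have "active r ?D X d z ?b'"
      proof (rule active_shift[OF that(1) \<open>z \<in> square ?D\<close>])
        show "crd d z = crd d v" using v(1)[OF that(3)] by simp
        have "int c \<le> int ?b" using that(2) by (rule of_nat_mono)
        thus "\<bar>crd (\<not> d) z - crd (\<not> d) v\<bar> + int c \<le> int ?b'"
          using v(2)[OF that(3)] r unfolding b by (simp add: abs_minus_commute)
      qed
      thus ?thesis by blast
    qed
    \<comment> \<open>Perpendicular lines through two distinct sites of one segment are parallel and
      at most 2r apart.\<close>
    have crossing: False
      if "chain r ?D (\<not> d) v c S" "chain r ?D (\<not> d) w c' S'" "S \<subseteq> X" "S' \<subseteq> X"
        "c \<le> ?b" "c' \<le> ?b" "v \<in> segment r d z" "w \<in> segment r d z" "v \<noteq> w" for v w c c' S S'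
    proof -
      have "crd (\<not> d) v \<noteq> crd (\<not> d) w"
        using v(1)[OF that(7)] v(1)[OF that(8)] that(9) site_eqI[of d v w] by auto
      moreover have "\<bar>crd (\<not> d) v - crd (\<not> d) w\<bar> \<le> 2 * r"
        using v(2)[OF that(7)] v(2)[OF that(8)] by linarith
      ultimately show False
        using close_lines_danger[OF that(1-4) budget[OF that(5)] budget[OF that(6)]] safe by blast
    qed
    have mixed: ?thesis
      if m: "v \<in> \<xi>\<^sub>0" "active r ?D X (\<not> d) w ?b" "v \<in> segment r d z" "w \<in> segment r d z" "v \<noteq> w" for v w
    proof -
      obtain S where S: "S \<subseteq> X" "chain r ?D (\<not> d) w ?b S" using m(2) unfolding active_def by blast
      have "v \<in> square ?D" "w \<in> square ?D" using v'[OF m(3)] v'[OF m(4)] sq_mono by blast+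
      hence "v \<in> X" using m(1) X by simp
      show ?thesis
      proof (cases "v \<in> S")
        case False
        have "chain r ?D d z ?b' (insert v S)"
          by (rule chain.step[OF \<open>z \<in> square ?D\<close> \<open>v \<in> square ?D\<close> \<open>w \<in> square ?D\<close> m(5) _ _ _ _ _ False S(2)])
            (use v[OF m(3)] v[OF m(4)] r in \<open>auto simp: algebra_simps\<close>)
        thus ?thesis using S(1) \<open>v \<in> X\<close> unfolding active_def by blast
      next
        case True
        \<comment> \<open>The chain of \<open>w\<close> already uses \<open>v\<close> and is
          restarted there. In direction \<open>d\<close> this activates the line of
          \<open>z\<close>; in the other direction it yields two close parallel lines.\<close>
        then obtain e c S' where S': "chain r ?D e v c S'" "S' \<subseteq> S" "c \<le> ?b"
          using chain_source[OF S(2)] by blast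
        show ?thesis
        proof (cases "e = d")
          case True
          thus ?thesis using S' S(1) m(3) by (intro same[of v c]) (auto simp: active_def)
        next
          case False
          hence "e = (\<not> d)" by auto
          hence "chain r ?D (\<not> d) v c S'" using S'(1) by simp
          thus ?thesis using crossing[OF _ S(2) _ S(1) S'(3) _ m(3-5)] S'(2) S(1) by auto
        qed
      qed
    qed
    have cases: "v \<in> \<xi>\<^sub>0 \<or> active r ?D X d v ?b \<or> active r ?D X (\<not> d) v ?b"
      if "v \<in> growth UNIV r Z2 \<xi>\<^sub>0 s" "v \<in> segment r d z" for v
      using IH[OF that]
    proof
      assume "\<exists>e. active r ?D X e v ?b"
      then obtain e where e: "active r ?D X e v ?b" ..
      have "e = d \<or> e = (\<not> d)" by auto
      thus ?thesis using e by (elim disjE) simp_all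
    qed simp
    consider "active r ?D X d v ?b \<or> active r ?D X d w ?b"
      | "v \<in> \<xi>\<^sub>0" "w \<in> \<xi>\<^sub>0"
      | "v \<in> \<xi>\<^sub>0" "active r ?D X (\<not> d) w ?b"
      | "w \<in> \<xi>\<^sub>0" "active r ?D X (\<not> d) v ?b"
      | "active r ?D X (\<not> d) v ?b" "active r ?D X (\<not> d) w ?b"
      using cases[OF new(2,4)] cases[OF new(3,5)] by blast
    thus ?thesis
    proof cases
      case 1
      thus ?thesis using same[of v ?b] same[of w ?b] new by blast
    next
      case 2
      have vw: "v \<in> square ?D" "w \<in> square ?D" using v'[OF new(4)] v'[OF new(5)] sq_mono by blast+
      moreover have "\<bar>crd (\<not> d) z - crd (\<not> d) v\<bar> \<le> int ?b'"
      proof -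
        have "0 \<le> 2 * r * int s" using r by simp
        thus ?thesis unfolding b using v(2)[OF new(4)] r by linarith
      qed
      moreover have "\<bar>crd (\<not> d) v - crd (\<not> d) w\<bar> \<le> 2 * r"
        using v(2)[OF new(4)] v(2)[OF new(5)] by linarith
      ultimately have "chain r ?D d z ?b' {v, w}"
        using v(1)[OF new(4)] v(1)[OF new(5)] new(6) \<open>z \<in> square ?D\<close>
        by (intro chain.seed)
      moreover have "{v, w} \<subseteq> X" using 2 X vw by simp
      ultimately show ?thesis unfolding active_def by blast
    next
      case 3
      thus ?thesis using mixed[OF _ _ new(4,5,6)] by blast
    next
      case 4
      thus ?thesis using mixed[OF _ _ new(5,4)] new(6) by blast
    next
      case 5
      thus ?thesis using crossing[OF _ _ _ _ _ _ new(4-6)] unfolding active_def by blast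
    qed
  qed
qed simp

section \<open>The lower bound on the occupation time\<close>

text \<open>A line active through \<open>site d c x\<close> is activated at distance \<open>j\<close> from this site in one of
  two directions, given by the sign \<open>k\<close>.\<close>

lemma active_cases:
  assumes r: "r \<ge> 1" and act: "active r D X d (site d c x) b"
  obtains (pair) j k l where "j \<le> b" "k \<in> {- 1, 1}" "l \<in> {- 2 * r..2 * r}" "l \<noteq> 0"
      "{site d c (x + k * int j), site d c (x + k * int j + l)} \<subseteq> X"
  | (branch) j k l where "j \<le> b" "k \<in> {- 1, 1}" "l \<in> {- 2 * r..2 * r}" "b > 0"
      "site d c (x + k * int j + l) \<in> X"
      "active r D (X - {site d c (x + k * int j + l)}) (\<not> d) (site d c (x + k * int j)) (min (b - j) (b - 1))"
proof -
  have sign: "\<exists>k\<in>{- 1, 1}. y = x + k * int (nat \<bar>y - x\<bar>)" for y :: int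
    by (cases "y \<ge> x") auto
  obtain S where S: "S \<subseteq> X" "chain r D d (site d c x) b S" using act unfolding active_def by blast
  from S(2) show ?thesis
  proof (cases rule: chain.cases)
    case (seed u w)
    define y where "y = crd (\<not> d) u"
    define j where "j = nat \<bar>y - x\<bar>"
    obtain k where k: "k \<in> {- 1, 1}" "y = x + k * int j" using sign[of y] unfolding j_def by blast
    have u: "u = site d c (x + k * int j)"
      using seed(6) k(2) by (intro site_eqI[of d]) (simp_all add: y_def)
    define l where "l = crd (\<not> d) w - y"
    have w: "w = site d c (x + k * int j + l)"
      using seed(7) k(2) by (intro site_eqI[of d]) (simp_all add: l_def)
    have "j \<le> b" using seed(9) by (simp add: y_def j_def abs_minus_commute)
    moreover have "l \<in> {- 2 * r..2 * r}" using seed(8) by (auto simp: l_def y_def)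
    moreover have "l \<noteq> 0" using seed(5) u w by auto
    moreover have "{site d c (x + k * int j), site d c (x + k * int j + l)} \<subseteq> X"
      using S(1) seed(1) u w by simp
    ultimately show ?thesis using pair k(1) by blast
  next
    case (step u v b' S0)
    define y where "y = crd (\<not> d) v"
    define j where "j = nat \<bar>y - x\<bar>"
    obtain k where k: "k \<in> {- 1, 1}" "y = x + k * int j" using sign[of y] unfolding j_def by blast
    have v: "v = site d c (x + k * int j)"
      using step(7) k(2) by (intro site_eqI[of d]) (simp_all add: y_def)
    define l where "l = crd (\<not> d) u - y"
    have u: "u = site d c (x + k * int j + l)"
      using step(6) k(2) by (intro site_eqI[of d]) (simp_all add: l_def)
    have dist: "\<bar>y - x\<bar> + int b' \<le> int b" using step(9) by (simp add: y_def abs_minus_commute)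
    \<comment> \<open>A step lowers the budget even at distance j = 0, as it costs at least 2r; the
      cap b - 1 makes the recursion in the budget well-founded.\<close>
    have "b' \<le> min (b - j) (b - 1)" using dist step(10) r unfolding j_def by linarith
    hence b': "\<bar>crd (\<not> \<not> d) v - crd (\<not> \<not> d) v\<bar> + int b' \<le> int (min (b - j) (b - 1))"
      using of_nat_mono[where ?'a = int] by simp
    have "S0 \<subseteq> X - {u}" using S(1) step(1,11) by auto
    hence "active r D (X - {u}) (\<not> d) v b'" using step(12) unfolding active_def by blast
    hence "active r D (X - {u}) (\<not> d) v (min (b - j) (b - 1))"
      using chain_in_square[OF step(12)] refl b' by (rule active_shift)
    moreover have "j \<le> b" "b > 0" using dist step(10) r unfolding j_def by linarith+
    moreover have "l \<in> {- 2 * r..2 * r}" using step(8) by (auto simp: l_def y_def)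
    moreover have "u \<in> X" using S(1) step(1) by simp
    ultimately show ?thesis using branch[of j k l] k(1) unfolding u v by blast
  qed
qed

text \<open>The bound P(b) obeys a recursion: a pair contributes at most 2 \<kappa> p^2 (b + 1), a
  branching at distance j contributes 2 \<kappa> p P(b - j), with P(b - 1) for j = 0. The powers of
  1/g sum to at most 1/(4 \<kappa> p), so the ansatz K g^b reproduces half of itself in the
  branchings, and K/2 dominates the pairs for all b up to B.\<close>

lemma rprob_active:
  fixes p :: real and r :: int
  defines "\<kappa> \<equiv> 4 * real_of_int r + 1"
  defines "g \<equiv> 1 / (1 - 4 * \<kappa> * p)"
  assumes r: "r \<ge> 1" and p: "0 < p" "8 * \<kappa> * p \<le> 1" and b: "b \<le> B" and F: "finite F"
  shows "rprob F p (\<lambda>X. active r D X d z b) \<le> 2 * \<kappa> * p\<^sup>2 * (2 * real B + 2) * g ^ b"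
  using b
proof (induction b arbitrary: d z rule: less_induct)
  case (less b)
  define K where "K = 2 * \<kappa> * p\<^sup>2 * (2 * real B + 2)"
  define h where "h = 1 - 4 * \<kappa> * p"
  define c where "c = crd d z"
  define x where "x = crd (\<not> d) z"
  have \<kappa>: "\<kappa> \<ge> 1" using r by (simp add: \<kappa>_def)
  have h: "h > 0" "h < 1" "g = 1 / h" using p \<kappa> by (auto simp: h_def g_def)
  have g: "g \<ge> 1" using h by simp
  have K: "K \<ge> 0" using \<kappa> by (simp add: K_def)
  have "p \<le> 8 * \<kappa> * p" using p(1) \<kappa> by simp
  hence p1: "p \<le> 1" using p by linarith
  let ?L = "{- 2 * r..2 * r}" and ?sgn = "{- 1, 1::int}"
  have card_L: "real (card ?L) = \<kappa>" using r by (simp add: \<kappa>_def)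
  have z: "z = site d c x" by (simp add: c_def x_def)
  let ?v = "\<lambda>j k. site d c (x + k * int j)" and ?u = "\<lambda>j k l. site d c (x + k * int j + l)"
  let ?I = "{..b} \<times> ?sgn \<times> (?L - {0})"
  let ?pair = "\<lambda>X. \<exists>(j, k, l)\<in>?I. {?v j k, ?u j k l} \<subseteq> X"
  let ?branch = "\<lambda>X. b > 0 \<and> (\<exists>j\<in>{..b}. \<exists>(k, l)\<in>?sgn \<times> ?L. ?u j k l \<in> X \<and>
      active r D (X - {?u j k l}) (\<not> d) (?v j k) (min (b - j) (b - 1)))"
  have "rprob F p (\<lambda>X. active r D X d z b) \<le> rprob F p (\<lambda>X. ?pair X \<or> ?branch X)"
  proof (rule rprob_mono[OF F])
    fix X assume "active r D X d z b"
    hence "active r D X d (site d c x) b" unfolding z .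
    with r show "?pair X \<or> ?branch X"
    proof (cases rule: active_cases)
      case (pair j k l)
      thus ?thesis by (intro disjI1 bexI[of _ "(j, k, l)"]) auto
    next
      case (branch j k l)
      thus ?thesis by (intro disjI2 conjI bexI[of _ j] bexI[of _ "(k, l)"]) auto
    qed
  qed
  also have "\<dots> \<le> rprob F p ?pair + rprob F p ?branch" by (rule rprob_disj)
  also have "rprob F p ?pair \<le> real (card ?I) * p ^ 2"
  proof (rule rprob_Bex_le)
    fix i assume "i \<in> ?I"
    then obtain j k l where i: "i = (j, k, l)" "l \<noteq> 0" by auto
    have "card {?v j k, ?u j k l} = 2" using i(2) by simp
    thus "rprob F p (\<lambda>X. case i of (j, k, l) \<Rightarrow> {?v j k, ?u j k l} \<subseteq> X) \<le> p ^ 2"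
      using rprob_subset[OF F _ p1, of "{?v j k, ?u j k l}"] p i by (simp add: power2_eq_square)
  qed simp
  also have "real (card ?I) * p ^ 2 \<le> K / 2 * g ^ b"
  proof -
    have "card (?L - {0}) \<le> card ?L" by (intro card_mono) auto
    hence "real (card (?L - {0})) \<le> \<kappa>" unfolding card_L[symmetric] by (rule of_nat_mono)
    hence "(real b + 1) * (2 * real (card (?L - {0}))) \<le> (real b + 1) * (2 * \<kappa>)"
      by (intro mult_left_mono) auto
    also have "(real b + 1) * (2 * real (card (?L - {0}))) = real (card ?I)"
      by (simp add: card_cartesian_product algebra_simps)
    finally have "real (card ?I) \<le> (real b + 1) * (2 * \<kappa>)" .
    also have "\<dots> \<le> (real B + 1) * (2 * \<kappa>)" using less.prems \<kappa> by (intro mult_right_mono) auto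
    finally have "real (card ?I) * p ^ 2 \<le> (real B + 1) * (2 * \<kappa>) * p ^ 2" by (intro mult_right_mono) auto
    also have "\<dots> = K / 2" by (simp add: K_def algebra_simps)
    also have "\<dots> \<le> K / 2 * g ^ b" using K g by (simp add: mult_le_cancel_left1 one_le_power)
    finally show ?thesis .
  qed
  also have "rprob F p ?branch \<le> K / 2 * g ^ b"
  proof (cases "b > 0")
    case True
    have "rprob F p ?branch \<le> (\<Sum>j\<le>b. rprob F p (\<lambda>X. \<exists>(k, l)\<in>?sgn \<times> ?L. ?u j k l \<in> X \<and>
      active r D (X - {?u j k l}) (\<not> d) (?v j k) (min (b - j) (b - 1))))"
      using True by (simp add: rprob_Bex)
    also have "\<dots> \<le> (\<Sum>j\<le>b. 2 * \<kappa> * p * K * g ^ b * h ^ j)"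
    proof (rule sum_mono)
      fix j assume j: "j \<in> {..b}"
      let ?c = "min (b - j) (b - 1)"
      have "rprob F p (\<lambda>X. \<exists>i\<in>?sgn \<times> ?L. case i of (k, l) \<Rightarrow> ?u j k l \<in> X \<and>
          active r D (X - {?u j k l}) (\<not> d) (?v j k) ?c)
        \<le> real (card (?sgn \<times> ?L)) * (p * (K * g ^ ?c))"
      proof (rule rprob_Bex_le)
        fix i assume "i \<in> ?sgn \<times> ?L"
        obtain k l where i: "i = (k, l)" by (cases i)
        have "rprob F p (\<lambda>X. ?u j k l \<in> X \<and> active r D (X - {?u j k l}) (\<not> d) (?v j k) ?c)
          \<le> p * rprob F p (\<lambda>X. active r D X (\<not> d) (?v j k) ?c)"
          using p p1 by (intro rprob_present_mono F) (auto intro: active_mono)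
        also have "\<dots> \<le> p * (K * g ^ ?c)"
          unfolding K_def using p True less.prems by (intro mult_left_mono less.IH) auto
        finally show "rprob F p (\<lambda>X. case i of (k, l) \<Rightarrow> ?u j k l \<in> X \<and>
          active r D (X - {?u j k l}) (\<not> d) (?v j k) ?c) \<le> p * (K * g ^ ?c)" unfolding i by simp
      qed simp
      also have "\<dots> \<le> real (card (?sgn \<times> ?L)) * (p * (K * g ^ (b - j)))"
        using p g K by (intro mult_left_mono power_increasing) auto
      also have "real (card (?sgn \<times> ?L)) = 2 * \<kappa>"
        unfolding card_L[symmetric] by (simp add: card_cartesian_product)
      also have "g ^ (b - j) = g ^ b * h ^ j"
        using j h by (simp add: power_diff power_one_over divide_inverse power_inverse)
      finally show "rprob F p (\<lambda>X. \<exists>(k, l)\<in>?sgn \<times> ?L. ?u j k l \<in> X \<and>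
          active r D (X - {?u j k l}) (\<not> d) (?v j k) ?c) \<le> 2 * \<kappa> * p * K * g ^ b * h ^ j"
        by (simp only: mult.assoc)
    qed
    also have "\<dots> = 2 * \<kappa> * p * K * g ^ b * (\<Sum>j\<le>b. h ^ j)" by (simp only: sum_distrib_left)
    also have "\<dots> \<le> 2 * \<kappa> * p * K * g ^ b * (1 / (1 - h))"
    proof (rule mult_left_mono)
      have "(\<Sum>j\<le>b. h ^ j) \<le> (\<Sum>j. h ^ j)" using h by (intro sum_le_suminf summable_geometric) auto
      thus "(\<Sum>j\<le>b. h ^ j) \<le> 1 / (1 - h)" using suminf_geometric[of h] h by simp
    qed (use p \<kappa> K g in simp)
    also have "\<dots> = K / 2 * g ^ b" using p \<kappa> by (simp add: h_def)
    finally show ?thesis .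
  qed (use K g in simp)
  finally show ?case unfolding K_def[symmetric] by simp
qed

section \<open>Probability of the danger events\<close>

lemma card_dangerous:
  assumes r: "r \<ge> 0" and D: "D \<ge> 0"
    and m: "card {i \<in> UNIV \<times> {- D..D}. active_line r D B X (fst i) (snd i)} \<le> m"
  shows "card {u \<in> square D. dangerous r D B X u} \<le> m * m * (nat (4 * r + 1) * nat (4 * r + 1))"
proof -
  let ?M = "{i \<in> UNIV \<times> {- D..D}. active_line r D B X (fst i) (snd i)}"
  let ?L = "{- 2 * r..2 * r}"
  define A where "A d = {c. active_line r D B X d c}" for d
  have A: "finite (A d)" "card (A d) \<le> m" for d
  proof -
    have sub: "Pair d ` A d \<subseteq> ?M" using active_line_bound by (fastforce simp: A_def abs_le_iff)
    have fin: "finite ?M" by simp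
    have inj: "inj_on (Pair d) (A d)" by (auto simp: inj_on_def)
    show "finite (A d)" using finite_imageD[OF finite_subset[OF sub fin] inj] .
    show "card (A d) \<le> m" using card_mono[OF fin sub] m by (simp add: card_image[OF inj])
  qed
  \<comment> \<open>A dangerous site is the crossing of an active row and an active column,
    displaced by at most 2r in each coordinate.\<close>
  let ?f = "\<lambda>((c, c'), (i, j)). (c' + j, c + i)"
  let ?P = "(A True \<times> A False) \<times> (?L \<times> ?L)"
  have "{u \<in> square D. dangerous r D B X u} \<subseteq> ?f ` ?P"
  proof
    fix u assume "u \<in> {u \<in> square D. dangerous r D B X u}"
    then obtain c c' where cc: "c \<in> A True" "c' \<in> A False" "\<bar>crd True u - c\<bar> \<le> 2 * r" "\<bar>crd False u - c'\<bar> \<le> 2 * r"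
      unfolding dangerous_def A_def by auto
    show "u \<in> ?f ` ?P"
      by (rule image_eqI[of _ _ "((c, c'), (crd True u - c, crd False u - c'))"])
        (use cc in \<open>auto simp: crd_def abs_le_iff\<close>)
  qed
  hence "card {u \<in> square D. dangerous r D B X u} \<le> card (?f ` ?P)"
    by (rule card_mono[rotated]) (use A in simp)
  also have "\<dots> \<le> card ?P" using A by (intro card_image_le) simp
  also have "\<dots> = (card (A True) * card (A False)) * (card ?L * card ?L)"
    by (simp only: card_cartesian_product)
  also have "card ?L = nat (4 * r + 1)" by simp
  also have "(card (A True) * card (A False)) * (nat (4 * r + 1) * nat (4 * r + 1))
      \<le> m * m * (nat (4 * r + 1) * nat (4 * r + 1))"
    using A by (intro mult_right_mono mult_mono) auto
  finally show ?thesis .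
qed

text \<open>The occupation of \<open>u\<close> is independent of \<open>dangerous\<close> for the set without \<open>u\<close>, so the expected number
  of occupied dangerous sites is at most \<open>p\<close> times that of dangerous sites, which is controlled once
  the number of active lines is.\<close>

lemma rprob_crossing_danger:
  assumes r: "r \<ge> 0" and D: "D \<ge> 0" and p: "0 < p" "p \<le> 1/2" and m: "m > 0"
    and Q: "\<And>d c. rprob (square D) p (\<lambda>X. active_line r D B X d c) \<le> Q"
  shows "rprob (square D) p (crossing_danger r D B)
    \<le> 2 * (2 * real_of_int D + 1) * Q / real m + 2 * p * (real m * (4 * real_of_int r + 1))\<^sup>2"
proof -
  let ?I = "(UNIV :: bool set) \<times> {- D..D}"
  define M where "M X = card {i \<in> ?I. active_line r D B X (fst i) (snd i)}" for X
  have M_mono: "M X \<le> M Y" if "X \<subseteq> Y" for X Y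
    unfolding M_def using that by (intro card_mono) (auto intro: active_line_mono)
  have fin: "finite (square D)" by (rule finite_square)
  have "rprob (square D) p (crossing_danger r D B) \<le> rprob (square D) p (\<lambda>X. real (M X) \<ge> real m \<or>
      (\<exists>u\<in>square D. u \<in> X \<and> dangerous r D B (X - {u}) u \<and> M (X - {u}) \<le> m))"
  proof (rule rprob_mono[OF fin])
    fix X assume X: "X \<subseteq> square D" and "crossing_danger r D B X"
    then obtain u where u: "u \<in> X" "dangerous r D B (X - {u}) u" unfolding crossing_danger_def by blast
    show "real (M X) \<ge> real m \<or> (\<exists>u\<in>square D. u \<in> X \<and> dangerous r D B (X - {u}) u \<and> M (X - {u}) \<le> m)"
    proof (cases "M X \<ge> m")
      case False
      hence "M (X - {u}) \<le> m" using M_mono[of "X - {u}" X] by auto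
      thus ?thesis using u X by blast
    qed simp
  qed
  also have "\<dots> \<le> rprob (square D) p (\<lambda>X. real (M X) \<ge> real m)
      + rprob (square D) p (\<lambda>X. \<exists>u\<in>square D. u \<in> X \<and> dangerous r D B (X - {u}) u \<and> M (X - {u}) \<le> m)"
    by (rule rprob_disj)
  also have "rprob (square D) p (\<lambda>X. real (M X) \<ge> real m)
      \<le> (\<Sum>i\<in>?I. rprob (square D) p (\<lambda>X. active_line r D B X (fst i) (snd i))) / real m"
    unfolding M_def using m by (intro prob_card_ge finite_set_random_subset fin) auto
  also have "\<dots> \<le> real (card ?I) * Q / real m"
    using m by (intro divide_right_mono sum_bounded_above Q) auto
  also have "real (card ?I) = 2 * (2 * real_of_int D + 1)"
    using D by (simp add: card_cartesian_product)
  also have "rprob (square D) p (\<lambda>X. \<exists>u\<in>square D. u \<in> X \<and> dangerous r D B (X - {u}) u \<and> M (X - {u}) \<le> m)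
      \<le> (\<Sum>u\<in>square D. rprob (square D) p (\<lambda>X. u \<in> X \<and> dangerous r D B (X - {u}) u \<and> M (X - {u}) \<le> m))"
    by (rule rprob_Bex[OF fin])
  \<comment> \<open>Danger is increasing in \<open>X\<close> but the cutoff by \<open>m\<close> is
    decreasing, hence \<open>rprob_present_absent\<close> in place of the monotone version.\<close>
  also have "\<dots> \<le> (\<Sum>u\<in>square D. 2 * p * rprob (square D) p (\<lambda>X. dangerous r D B X u \<and> M X \<le> m))"
    using p by (intro sum_mono rprob_present_absent fin) auto
  also have "\<dots> = 2 * p * (\<Sum>u\<in>square D. rprob (square D) p (\<lambda>X. dangerous r D B X u \<and> M X \<le> m))"
    by (simp only: sum_distrib_left)
  also have "\<dots> \<le> 2 * p * real (m * m * (nat (4 * r + 1) * nat (4 * r + 1)))"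
  proof (intro mult_left_mono sum_prob_le_card finite_set_random_subset fin)
    fix X
    show "card {u \<in> square D. dangerous r D B X u \<and> M X \<le> m} \<le> m * m * (nat (4 * r + 1) * nat (4 * r + 1))"
      using card_dangerous[OF r D, of B X m] by (cases "M X \<le> m") (auto simp: M_def)
  qed (use p in simp)
  also have "real (m * m * (nat (4 * r + 1) * nat (4 * r + 1))) = (real m * (4 * real_of_int r + 1))\<^sup>2"
    using r by (simp add: power2_eq_square)
  finally show ?thesis by simp
qed

text \<open>The chain of the close line avoids both sites of the pair, so they can be removed one
  after the other for a factor p each. The remaining factors count directions, positions of
  \<open>u\<close>, and offsets of \<open>w\<close> and of the line.\<close>

lemma rprob_seed_danger:
  assumes r: "r \<ge> 0" and D: "D \<ge> 0" and p: "0 \<le> p" "p \<le> 1"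
    and Q: "\<And>d c. rprob (square D) p (\<lambda>X. active_line r D B X d c) \<le> Q"
  shows "rprob (square D) p (seed_danger r D B)
    \<le> 2 * (2 * real_of_int D + 1)\<^sup>2 * (4 * real_of_int r + 1)\<^sup>2 * (p * (p * Q))"
proof -
  let ?L = "{- 2 * r..2 * r}"
  let ?I = "(UNIV :: bool set) \<times> square D \<times> ?L \<times> ?L"
  let ?w = "\<lambda>d u l. site d (crd d u) (crd (\<not> d) u + l)"
  let ?E = "\<lambda>(d, u, l, k) X. ?w d u l \<in> X \<and> active_line r D B (X - {?w d u l}) d (crd d u + k)"
  have fin: "finite (square D)" by (rule finite_square)
  have mono: "?E i X \<Longrightarrow> X \<subseteq> Y \<Longrightarrow> ?E i Y" for i X Y
    by (cases i) (auto elim!: active_line_mono)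
  have "rprob (square D) p (seed_danger r D B)
      \<le> rprob (square D) p (\<lambda>X. \<exists>i\<in>?I. fst (snd i) \<in> X \<and> ?E i (X - {fst (snd i)}))"
  proof (rule rprob_mono[OF fin])
    fix X assume X: "X \<subseteq> square D" and "seed_danger r D B X"
    then obtain d u w c where *: "u \<in> X" "w \<in> X - {u}" "crd d u = crd d w"
      "\<bar>crd (\<not> d) u - crd (\<not> d) w\<bar> \<le> 2 * r" "\<bar>crd d u - c\<bar> \<le> 2 * r"
      "active_line r D B (X - {u} - {w}) d c"
      unfolding seed_danger_def by blast
    have w: "?w d u (crd (\<not> d) w - crd (\<not> d) u) = w" using *(3) by simp
    show "\<exists>i\<in>?I. fst (snd i) \<in> X \<and> ?E i (X - {fst (snd i)})"
      using X * w
      by (intro bexI[of _ "(d, u, crd (\<not> d) w - crd (\<not> d) u, c - crd d u)"]) (auto simp: abs_le_iff)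
  qed
  also have "\<dots> \<le> real (card ?I) * (p * (p * Q))"
  proof (rule rprob_Bex_le)
    fix i assume "i \<in> ?I"
    obtain d u l k where i: "i = (d, u, l, k)" by (cases i)
    have "rprob (square D) p (\<lambda>X. fst (snd i) \<in> X \<and> ?E i (X - {fst (snd i)})) \<le> p * rprob (square D) p (?E i)"
      using p mono by (intro rprob_present_mono fin) blast+
    also have "rprob (square D) p (?E i) \<le> p * rprob (square D) p (\<lambda>X. active_line r D B X d (crd d u + k))"
      unfolding i prod.case using p active_line_mono by (intro rprob_present_mono fin) blast+
    also have "\<dots> \<le> p * Q" using p by (intro mult_left_mono Q)
    finally show "rprob (square D) p (\<lambda>X. fst (snd i) \<in> X \<and> ?E i (X - {fst (snd i)})) \<le> p * (p * Q)"
      using p by (simp add: mult_left_mono)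
  qed (simp add: fin)
  also have "real (card ?I) = 2 * (2 * real_of_int D + 1)\<^sup>2 * (4 * real_of_int r + 1)\<^sup>2"
    using r D by (simp add: card_cartesian_product square_def power2_eq_square)
  finally show ?thesis .
qed

text \<open>By \<open>growth_covered\<close> the origin is occupied initially, lies on an active
  line, or there is danger. \<open>B\<close> adds to the budget 2rt of the dynamics the distance D =
  rt for moving a reference point to position 0.\<close>

lemma prob_origin_occupied:
  fixes p :: real and r :: int and t :: nat
  defines "\<kappa> \<equiv> 4 * real_of_int r + 1"
  defines "D \<equiv> r * int t" and "B \<equiv> nat (3 * r * int t)"
  defines "Q \<equiv> 2 * \<kappa> * p\<^sup>2 * (2 * real B + 2) * (1 / (1 - 4 * \<kappa> * p)) ^ B"
  assumes r: "r \<ge> 1" and p: "0 < p" "8 * \<kappa> * p \<le> 1" and m: "m > 0"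
    and E: "\<And>\<omega>. E \<omega> \<Longrightarrow> (0, 0) \<in> growth UNIV r Z2 (Collect \<omega>) t"
  shows "measure (site_measure p) {\<omega>. E \<omega>}
    \<le> p + 2 * Q + (2 * (2 * real_of_int D + 1) * Q / real m + 2 * p * (real m * \<kappa>)\<^sup>2)
      + 2 * (2 * real_of_int D + 1)\<^sup>2 * \<kappa>\<^sup>2 * (p * (p * Q))"
proof -
  have "\<kappa> \<ge> 5" using r by (simp add: \<kappa>_def)
  hence "8 * 5 * p \<le> 8 * \<kappa> * p" using p by (intro mult_right_mono) auto
  hence p1: "p \<le> 1/2" using p by linarith
  have rt: "0 \<le> r * int t" using r by simp
  have D: "D \<ge> 0" using rt by (simp add: D_def)
  have intB: "int B = 3 * r * int t" using r by (simp add: B_def)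
  have fin: "finite (square D)" by (rule finite_square)
  have line: "rprob (square D) p (\<lambda>X. active_line r D B X d c) \<le> Q" for d c
    unfolding active_line_def Q_def \<kappa>_def
    by (rule rprob_active[OF r p(1) p(2)[unfolded \<kappa>_def] order_refl fin])
  let ?cd = "crossing_danger r D B" and ?sd = "seed_danger r D B"
  let ?al = "\<lambda>X. \<exists>d\<in>(UNIV :: bool set). active_line r D B X d 0"
  have "measure (site_measure p) {\<omega>. E \<omega>}
      \<le> rprob (square D) p (\<lambda>X. (({(0, 0)} \<subseteq> X \<or> ?al X) \<or> ?cd X) \<or> ?sd X)"
  proof (rule site_measure_le_rprob[OF fin])
    fix \<omega> assume "E \<omega>"
    hence grown: "(0, 0) \<in> growth UNIV r Z2 (Collect \<omega>) t" by (rule E)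
    define X where "X = Collect \<omega> \<inter> square D"
    have origin: "(0, 0) \<in> square (r * (int t - int t))" "(0, 0) \<in> square D"
      using D by (auto simp: square_def)
    show "(({(0, 0)} \<subseteq> X \<or> ?al X) \<or> ?cd X) \<or> ?sd X"
    proof (rule ccontr)
      assume neg: "\<not> ?thesis"
      have "(0, 0) \<in> Collect \<omega> \<or> (\<exists>d. active r (r * int t) X d (0, 0) (nat (2 * r * int t)))"
        using growth_covered[of r X "Collect \<omega>" t B t "(0, 0)"] r neg grown origin(1)
        by (auto simp: X_def D_def intB)
      moreover have "active_line r D B X d 0" if "active r D X d (0, 0) (nat (2 * r * int t))" for d
      proof -
        have "crd d (0, 0) = 0" by (cases d) (simp_all add: crd_def)
        moreover have "D + int (nat (2 * r * int t)) \<le> int B" using rt r intB by (simp add: D_def)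
        ultimately show ?thesis using active_imp_line[OF that, of B] by simp
      qed
      ultimately show False using neg origin(2) by (auto simp: X_def D_def)
    qed
  qed (use p p1 in auto)
  also have "\<dots> \<le> ((rprob (square D) p (\<lambda>X. {(0, 0)} \<subseteq> X) + rprob (square D) p ?al)
      + rprob (square D) p ?cd) + rprob (square D) p ?sd"
    by (intro order_trans[OF rprob_disj] add_right_mono order_refl)
  also have "\<dots> \<le> ((p + real (card (UNIV :: bool set)) * Q)
      + (2 * (2 * real_of_int D + 1) * Q / real m + 2 * p * (real m * \<kappa>)\<^sup>2))
      + 2 * (2 * real_of_int D + 1)\<^sup>2 * \<kappa>\<^sup>2 * (p * (p * Q))"
  proof (intro add_mono)
    show "rprob (square D) p (\<lambda>X. {(0, 0)} \<subseteq> X) \<le> p"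
      using rprob_subset[OF fin, of p "{(0, 0)}"] p p1 by simp
    show "rprob (square D) p ?al \<le> real (card (UNIV :: bool set)) * Q"
      by (rule rprob_Bex_le) (auto intro: line)
    show "rprob (square D) p ?cd \<le> 2 * (2 * real_of_int D + 1) * Q / real m + 2 * p * (real m * \<kappa>)\<^sup>2"
      unfolding \<kappa>_def using r D p p1 m line by (intro rprob_crossing_danger) auto
    show "rprob (square D) p ?sd \<le> 2 * (2 * real_of_int D + 1)\<^sup>2 * \<kappa>\<^sup>2 * (p * (p * Q))"
      unfolding \<kappa>_def using r D p p1 line by (intro rprob_seed_danger) auto
  qed
  finally show ?thesis by simp
qed

section \<open>The time scale and the passage to the limit\<close>

lemma inverse_one_minus_power_le:
  assumes "0 \<le> (x::real)" "x \<le> 1/2"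
  shows "(1 / (1 - x)) ^ n \<le> exp (2 * x * real n)"
proof -
  have "x * (1 - 2 * x) \<ge> 0" using assms by (intro mult_nonneg_nonneg) auto
  hence "1 / (1 - x) \<le> 1 + 2 * x" using assms by (simp add: field_simps)
  also have "\<dots> \<le> exp (2 * x)" by (rule exp_ge_add_one_self)
  finally have "(1 / (1 - x)) ^ n \<le> exp (2 * x) ^ n" using assms by (intro power_mono) auto
  thus ?thesis by (simp add: exp_of_nat_mult[symmetric] mult_ac)
qed

text \<open>With \<open>t = l / p log (1/p)\<close>, a line is active with probability at most \<open>p powr (1 - O(l))\<close> and the
  cutoff \<open>m\<close> for the number of active lines is \<open>p powr (- 1/4)\<close>.\<close>

lemma prob_origin_occupied_le:
  fixes p l :: real and r :: int
  defines "\<rho> \<equiv> real_of_int r" and "\<kappa> \<equiv> 4 * real_of_int r + 1" and "a \<equiv> 1 / p * ln (1 / p)"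
  defines "Q \<equiv> 2 * \<kappa> * p\<^sup>2 * (6 * \<rho> * a + 2) * p powr (- 1/8)"
  assumes r: "r \<ge> 1" and p: "0 < p" "8 * \<kappa> * p \<le> 1" and l: "0 < l" "l \<le> 1" "192 * \<kappa> * \<rho> * l \<le> 1"
    and t: "real t \<le> l * a"
    and E: "\<And>\<omega>. E \<omega> \<Longrightarrow> (0, 0) \<in> growth UNIV r Z2 (Collect \<omega>) t"
  shows "measure (site_measure p) {\<omega>. E \<omega>}
    \<le> p + 2 * Q + (2 * (2 * (\<rho> * a) + 1) * Q * p powr (1/4) + 2 * p * (2 * p powr (- 1/4) * \<kappa>)\<^sup>2)
      + 2 * (2 * (\<rho> * a) + 1)\<^sup>2 * \<kappa>\<^sup>2 * (p * (p * Q))"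
proof -
  have \<rho>: "\<rho> \<ge> 1" using r by (simp add: \<rho>_def)
  have \<kappa>: "\<kappa> \<ge> 5" using r by (simp add: \<kappa>_def)
  have "8 * 5 * p \<le> 8 * \<kappa> * p" using p \<kappa> by (intro mult_right_mono) auto
  hence p1: "p < 1" using p by linarith
  have a0: "a \<ge> 0" using p p1 by (simp add: a_def)
  have "l * a \<le> 1 * a" using l a0 by (intro mult_right_mono) auto
  hence ta: "real t \<le> a" using t by simp
  define D where "D = r * int t"
  define B where "B = nat (3 * r * int t)"
  define Q' where "Q' = 2 * \<kappa> * p\<^sup>2 * (2 * real B + 2) * (1 / (1 - 4 * \<kappa> * p)) ^ B"
  define m where "m = nat \<lceil>p powr (- 1/4)\<rceil>"
  have D: "0 \<le> real_of_int D" "real_of_int D \<le> \<rho> * a"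
    using ta \<rho> by (auto simp: D_def \<rho>_def intro: mult_left_mono)
  have realB: "real B = 3 * \<rho> * real t" using r by (simp add: B_def \<rho>_def)
  have B: "2 * real B + 2 \<le> 6 * \<rho> * a + 2" unfolding realB using ta \<rho> by simp
  have "(1 / (1 - 4 * \<kappa> * p)) ^ B \<le> exp (2 * (4 * \<kappa> * p) * real B)"
    using p \<kappa> by (intro inverse_one_minus_power_le) auto
  \<comment> \<open>The exponent is at most 24 \<kappa> \<rho> l log(1/p), and 192 = 8 * 24 makes
    this an eighth of log(1/p).\<close>
  also have "\<dots> \<le> exp (ln (1 / p) / 8)"
  proof -
    have "2 * (4 * \<kappa> * p) * real B = 24 * \<kappa> * \<rho> * p * real t" by (simp add: realB)
    also have "\<dots> \<le> 24 * \<kappa> * \<rho> * p * (l * a)" using p \<kappa> \<rho> t by (intro mult_left_mono) auto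
    also have "\<dots> = (192 * \<kappa> * \<rho> * l) * (ln (1 / p) / 8)" using p by (simp add: a_def)
    also have "\<dots> \<le> 1 * (ln (1 / p) / 8)" using l p p1 by (intro mult_right_mono) auto
    finally show ?thesis by simp
  qed
  also have "\<dots> = p powr (- 1/8)" using p by (simp add: powr_def ln_div)
  finally have g: "(1 / (1 - 4 * \<kappa> * p)) ^ B \<le> p powr (- 1/8)" .
  have g0: "(1 / (1 - 4 * \<kappa> * p)) ^ B \<ge> 0" using p by (intro zero_le_power) auto
  have Q': "0 \<le> Q'" "Q' \<le> Q"
  proof -
    show "0 \<le> Q'" unfolding Q'_def using \<kappa> g0 by (intro mult_nonneg_nonneg) auto
    show "Q' \<le> Q" unfolding Q'_def Q_def using \<kappa> g g0 B a0 \<rho> by (intro mult_mono) auto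
  qed
  have big: "p powr (- 1/4) \<ge> 1" using powr_mono'[of "- 1/4" 0 p] p p1 by simp
  have m: "p powr (- 1/4) \<le> real m" "real m \<le> 2 * p powr (- 1/4)" using big unfolding m_def by linarith+
  have m0: "m > 0" using m(1) big by (cases m) auto
  have inv_m: "1 / real m \<le> p powr (1/4)"
  proof -
    have "1 / real m \<le> 1 / p powr (- 1/4)" using m(1) big by (intro divide_left_mono mult_pos_pos) auto
    thus ?thesis by (simp add: powr_minus_divide)
  qed
  have "measure (site_measure p) {\<omega>. E \<omega>}
    \<le> p + 2 * Q' + (2 * (2 * real_of_int D + 1) * Q' * (1 / real m) + 2 * p * (real m * \<kappa>)\<^sup>2)
      + 2 * (2 * real_of_int D + 1)\<^sup>2 * \<kappa>\<^sup>2 * (p * (p * Q'))"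
    using prob_origin_occupied[OF r p[unfolded \<kappa>_def] m0, of E t, OF E]
    by (simp add: Q'_def D_def B_def \<kappa>_def)
  also have "\<dots> \<le> p + 2 * Q + (2 * (2 * (\<rho> * a) + 1) * Q * p powr (1/4) + 2 * p * (2 * p powr (- 1/4) * \<kappa>)\<^sup>2)
      + 2 * (2 * (\<rho> * a) + 1)\<^sup>2 * \<kappa>\<^sup>2 * (p * (p * Q))"
    using D Q' inv_m m(2) p \<kappa> \<rho> a0 by (intro add_mono mult_mono power_mono order_refl) auto
  finally show ?thesis .
qed

text \<open>Up to logarithms a is of order 1/p and Q of order p powr (7/8). The five summands thus
  have the exponents 1, 7/8, -1 + 7/8 + 1/4 = 1/8, 1 - 1/2 = 1/2 and -2 + 2 + 7/8 = 7/8, all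
  positive.\<close>

lemma origin_bound_tendsto_0:
  fixes \<rho> \<kappa> :: real
  assumes "\<rho> > 0" "\<kappa> > 0"
  defines "a \<equiv> \<lambda>p. 1 / p * ln (1 / p)"
  defines "Q \<equiv> \<lambda>p. 2 * \<kappa> * p\<^sup>2 * (6 * \<rho> * a p + 2) * p powr (- 1/8)"
  shows "((\<lambda>p. p + 2 * Q p + (2 * (2 * (\<rho> * a p) + 1) * Q p * p powr (1/4)
      + 2 * p * (2 * p powr (- 1/4) * \<kappa>)\<^sup>2)
      + 2 * (2 * (\<rho> * a p) + 1)\<^sup>2 * \<kappa>\<^sup>2 * (p * (p * Q p))) \<longlongrightarrow> 0) (at_right 0)"
  unfolding Q_def a_def using assms(1,2) by real_asymp

lemma origin_occupied_if_time_le: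
  assumes "ereal_of_enat (occupation_time r Z2 X) \<le> ereal x" "x \<ge> 0"
  shows "(0, 0) \<in> growth UNIV r Z2 X (nat \<lfloor>x\<rfloor>)"
proof -
  let ?S = "{t. (0, 0) \<in> growth UNIV r Z2 X t}"
  have "?S \<noteq> {}"
  proof
    assume "?S = {}"
    hence "occupation_time r Z2 X = \<infinity>" by (simp add: occupation_time_def top_enat_def)
    thus False using assms(1) by simp
  qed
  then obtain n where n: "n \<in> ?S" "(INF t\<in>?S. enat t) = enat n" using enat_INF_attained[of ?S] by blast
  have "real n \<le> x" using assms(1) n(2) by (simp add: occupation_time_def)
  hence "n \<le> nat \<lfloor>x\<rfloor>" by (simp add: le_nat_floor)
  thus ?thesis using n(1) growth_le[of n "nat \<lfloor>x\<rfloor>" UNIV r Z2 X] by auto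
qed

lemma occupation_time_gtrsim:
  assumes r: "r \<ge> 1"
  shows "prob_gtrsim site_measure
    (\<lambda>p \<omega>. ereal_of_enat (occupation_time r Z2 (Collect \<omega>))) (\<lambda>p. 1 / p * ln (1 / p))"
  unfolding prob_gtrsim_def
proof (rule Limsup_tendsto_0)
  fix \<epsilon> :: real assume \<epsilon>: "\<epsilon> > 0"
  let ?\<rho> = "real_of_int r" and ?\<kappa> = "4 * real_of_int r + 1"
  have pos: "?\<rho> > 0" "?\<kappa> > 0" using r by auto
  have ev: "eventually (\<lambda>p::real. 0 < p \<and> p < 1 / (8 * ?\<kappa>)) (at_right 0)"
    using pos by (intro eventually_small_p) simp
  have ev1: "eventually (\<lambda>p::real. 0 < p \<and> p < 1) (at_right 0)" by (intro eventually_small_p) simp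
  note small = order_tendstoD(2)[OF origin_bound_tendsto_0[OF pos] \<epsilon>]
  have "eventually (\<lambda>p. \<P>(\<omega> in site_measure p. ereal_of_enat (occupation_time r Z2 (Collect \<omega>))
      \<le> ereal (l * (1 / p * ln (1 / p)))) \<le> \<epsilon>) (at_right 0)"
    if l: "0 < l \<and> l < min 1 (1 / (192 * ?\<kappa> * ?\<rho>))" for l
    using small ev ev1
  proof eventually_elim
    case (elim p)
    have p: "0 < p" "8 * ?\<kappa> * p \<le> 1" "p < 1" using elim pos by (auto simp: field_simps)
    have "0 < 192 * ?\<kappa> * ?\<rho>" using pos by simp
    moreover have "l < 1 / (192 * ?\<kappa> * ?\<rho>)" using l by simp
    ultimately have "l * (192 * ?\<kappa> * ?\<rho>) < 1" by (simp only: pos_less_divide_eq)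
    hence l': "0 < l" "l \<le> 1" "192 * ?\<kappa> * ?\<rho> * l \<le> 1" using l by (simp_all add: mult.commute)
    let ?x = "l * (1 / p * ln (1 / p))"
    have x: "?x \<ge> 0" using p l' by simp
    hence t: "real (nat \<lfloor>?x\<rfloor>) \<le> ?x" by simp
    have origin: "(0, 0) \<in> growth UNIV r Z2 (Collect \<omega>) (nat \<lfloor>?x\<rfloor>)"
      if "ereal_of_enat (occupation_time r Z2 (Collect \<omega>)) \<le> ereal ?x" for \<omega>
      using that x by (rule origin_occupied_if_time_le)
    have "measure (site_measure p) {\<omega>. ereal_of_enat (occupation_time r Z2 (Collect \<omega>)) \<le> ereal ?x} \<le> \<epsilon>"
      by (rule less_imp_le[OF le_less_trans[OF prob_origin_occupied_le[OF r p(1,2) l' t] elim(1)]])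
        (rule origin)
    thus ?case by simp
  qed
  moreover have "eventually (\<lambda>l. 0 < l \<and> l < min 1 (1 / (192 * ?\<kappa> * ?\<rho>))) (at_right 0)"
    using pos by (intro eventually_small_p) auto
  ultimately show "eventually (\<lambda>l. eventually (\<lambda>p. \<P>(\<omega> in site_measure p.
      ereal_of_enat (occupation_time r Z2 (Collect \<omega>)) \<le> ereal (l * (1 / p * ln (1 / p)))) \<le> \<epsilon>) (at_right 0)) (at_right 0)"
    by (rule eventually_mono[rotated])
qed simp

theorem theorem1p3:
  fixes \<rho> :: int
  assumes "\<rho> \<ge> 2"
  shows "prob_asymp site_measure
           (\<lambda>p \<omega>. ereal_of_enat (occupation_time \<rho> ({0, 1} \<times> {0, 1}) (Collect \<omega>)))
           (\<lambda>p. 1 / p * ln (1 / p))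
       \<and> (\<forall>\<^sub>F p in at_right 0. critical_length \<rho> ({0, 1} \<times> {0, 1}) p < \<infinity>)
       \<and> (\<lambda>p. real (the_enat (critical_length \<rho> ({0, 1} \<times> {0, 1}) p)))
           \<in> \<Theta>[at_right 0](\<lambda>p. 1 / p)"
  unfolding Z2_def[symmetric]
proof (intro conjI)
  show "prob_asymp site_measure
      (\<lambda>p \<omega>. ereal_of_enat (occupation_time \<rho> Z2 (Collect \<omega>))) (\<lambda>p. 1 / p * ln (1 / p))"
    unfolding prob_asymp_def
    using occupation_time_lesssim[OF assms] occupation_time_gtrsim[of \<rho>] assms by simp
  obtain c C where cC: "c > 0" "C > 0"
    and ev: "eventually (\<lambda>p. \<exists>n. critical_length \<rho> Z2 p = enat n \<and> c / p \<le> real n \<and> real n \<le> C / p) (at_right 0)"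
    using critical_length_bounds[OF assms] .
  show "\<forall>\<^sub>F p in at_right 0. critical_length \<rho> Z2 p < \<infinity>"
    using ev by eventually_elim auto
  have "\<forall>\<^sub>F p in at_right 0. c * norm (1 / p) \<le> norm (real (the_enat (critical_length \<rho> Z2 p))) \<and>
      norm (real (the_enat (critical_length \<rho> Z2 p))) \<le> C * norm (1 / p)"
    using ev eventually_small_p[of 1, simplified] by eventually_elim auto
  thus "(\<lambda>p. real (the_enat (critical_length \<rho> Z2 p))) \<in> \<Theta>[at_right 0](\<lambda>p. 1 / p)"
    by (rule bigthetaI'[OF cC])
qed

end
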